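(* Let $r>0$ be real, let $q=e^{-\pi\sqrt r}$, and let $k\in(0,1)$ be the solution of $K(\sqrt{1-k^2})/K(k)=\sqrt r$, equivalently $$k=\frac{8q^{1/2}\phi(-q)^{12}}{1+\sqrt{1+64q\,\phi(-q)^{24}}}.$$ Set $k_{11}=k$, $k_{12}=\sqrt{1-k_{11}^2}$, $k_{21}=(2-k_{11}^2-2k_{12})/k_{11}^2$, $k_{22}=\sqrt{1-k_{21}^2}$. Then for every $m\in\mathbb Z$, $$\sum_{n=-\infty}^{\infty}q^{n^2+2mn}=2^{1/6}q^{-m^2}\frac{(k_{11}k_{22})^{1/3}}{(k_{12}k_{21})^{1/6}}\sqrt{\frac{K(k_{11})}{\pi}}$$ and $$\sum_{n=-\infty}^{\infty}q^{n^2+(2m+1)n}=2^{5/6}q^{-\frac14(2m+1)^2}\frac{(k_{11}k_{12}k_{21})^{1/6}}{k_{22}^{1/3}}\sqrt{\frac{K(k_{11})}{\pi}}.$$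
   Context: $K(x)=\int_0^{\pi/2}\frac{dt}{\sqrt{1-x^2\sin^2 t}}$ for $0\le x<1$ is the complete elliptic integral of the first kind (as a function of the modulus $x$). $\phi(-q)=(-q;q)_\infty=\prod_{n=1}^{\infty}(1+q^n)$. All roots are positive real roots. *)

theory Defs
  imports "HOL-Analysis.Analysis"
begin

(* Complete elliptic integral of the first kind as a function of the modulus x
   (not of the parameter x^2); meaningful for 0 <= x < 1. *)
definition ellK :: "real \<Rightarrow> real" where
  "ellK x = integral {0..pi/2} (\<lambda>t. 1 / sqrt (1 - x\<^sup>2 * (sin t)\<^sup>2))"

(* The infinite q-Pochhammer symbol (a;q)_infinity; convergent for |q| < 1. *)
definition qpochhammer_inf :: "real \<Rightarrow> real \<Rightarrow> real" where
  "qpochhammer_inf a q = (\<Prod>n. 1 - a * q ^ n)"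

(* phi_neg q is the quantity usually written phi(-q) = (-q;q)_infinity, that is, the
   product of 1 + q^n over n >= 1.  It is indexed by q, not by -q. *)
definition phi_neg :: "real \<Rightarrow> real" where
  "phi_neg q = qpochhammer_inf (-q) q"

end

theory Submission
  imports Defs
begin

text \<open>
  The solution \<open>k\<close> of \<open>K(k')/K(k) = \<surd>r\<close>, where \<open>k' = \<surd>(1 - k\<^sup>2)\<close>, is
  \<open>\<theta>\<^sub>2(q)\<^sup>2 / \<theta>\<^sub>3(q)\<^sup>2\<close>, the modulus with nome \<open>q\<close>, and then \<open>K(k) = (\<pi>/2) \<theta>\<^sub>3(q)\<^sup>2\<close>. Given this,
  both series are classical constants in disguise: completing the square turns the exponents
  \<open>n\<^sup>2 + 2mn\<close> and \<open>n\<^sup>2 + (2m+1)n\<close> into \<open>(n+m)\<^sup>2\<close> and \<open>(n+m+1/2)\<^sup>2\<close> up to a constant, so the series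
  are \<open>q^(-m^2) \<theta>\<^sub>3(q)\<close> and a power of \<open>q\<close> times \<open>\<theta>\<^sub>2(q) = \<surd>k \<theta>\<^sub>3(q)\<close>. The moduli \<open>k\<^sub>2\<^sub>1\<close> and
  \<open>k\<^sub>2\<^sub>2\<close> are those of the Landen transformation, \<open>k\<^sub>2\<^sub>1 = (1 - k')/(1 + k')\<close>, and the
  algebraic factors in the statement collapse to \<open>2\<^sup>1\<^sup>/\<^sup>3\<close> and \<open>2\<^sup>-\<^sup>1\<^sup>/\<^sup>3 \<surd>k\<close>
  (\<open>landen_modulus_identities\<close>).

  Both complete integrals come from Gauss's integral \<open>I(a, b)\<close>, which is invariant under the step
  \<open>(a, b) \<mapsto> ((a+b)/2, \<surd>(ab))\<close> (\<open>gauss_integral_agm\<close>). The duplication formulas for theta constants,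
  which follow from \<open>theta_mult\<close>, say that passing from \<open>q\<close> to \<open>q\<^sup>2\<close> is such a step for
  \<open>(\<theta>\<^sub>3\<^sup>2, \<theta>\<^sub>4\<^sup>2)\<close>, and that passing from \<open>q\<^sup>2\<close> back to \<open>q\<close> is such a step, up to a factor \<open>1/2\<close>, for
  \<open>(\<theta>\<^sub>3\<^sup>2, \<theta>\<^sub>2\<^sup>2)\<close>. Hence \<open>I(\<theta>\<^sub>3\<^sup>2, \<theta>\<^sub>4\<^sup>2)\<close> does not change along \<open>q, q\<^sup>2, q\<^sup>4, \<dots>\<close> and equals
  \<open>I(1, 1) = \<pi>/2\<close>, whereas \<open>J(q) = I(\<theta>\<^sub>3\<^sup>2, \<theta>\<^sub>2\<^sup>2)\<close> satisfies \<open>J(q\<^sup>2) = 2 J(q)\<close>. The logarithmic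
  singularity of \<open>I(a, b)\<close> as \<open>b \<rightarrow> 0\<close> then determines \<open>J(q) = -(ln q)/2\<close>. Dividing gives
  \<open>K(k')/K(k) = -(ln q)/\<pi> = \<surd>r\<close>; uniqueness of \<open>k\<close> is the monotonicity of this quotient.

  The expression of \<open>k\<close> through \<open>\<phi>(-q)\<close> needs infinite products. The Jacobi triple product is
  obtained as the limit of its finite version for \<open>q\<close>-binomial coefficients, and together with
  Euler's identity \<open>\<Prod>(1+q\<^sup>n)(1-q\<^sup>2\<^sup>n\<^sup>-\<^sup>1) = 1\<close> it gives \<open>\<theta>\<^sub>2\<^sup>2 \<theta>\<^sub>3\<^sup>2 / \<theta>\<^sub>4\<^sup>4 = 4 \<surd>q \<phi>(-q)\<^sup>1\<^sup>2\<close>. By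
  \<open>\<theta>\<^sub>2\<^sup>4 + \<theta>\<^sub>4\<^sup>4 = \<theta>\<^sub>3\<^sup>4\<close>, this is a quadratic equation for \<open>k\<close>.
\<close>

section \<open>Two-variable theta series\<close>

lemma summable_on_intI:
  fixes f :: "int \<Rightarrow> real"
  assumes "summable (\<lambda>n. \<bar>f (int n)\<bar>)" and "summable (\<lambda>n. \<bar>f (- int n)\<bar>)"
  shows "f summable_on UNIV"
proof -
  have "(\<lambda>n. f (int n)) summable_on UNIV" "(\<lambda>n. f (- int n)) summable_on UNIV"
    using assms by (auto intro: norm_summable_imp_summable_on)
  then have "f summable_on range int" "f summable_on range (\<lambda>n. - int n)"
    by (subst summable_on_reindex; simp add: o_def inj_on_def)+
  then have "f summable_on (range int \<union> range (\<lambda>n. - int n))"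
    by (rule summable_on_union)
  moreover have "range int \<union> range (\<lambda>n. - int n) = UNIV"
    by (auto simp: image_iff) (metis int_cases2)
  ultimately show ?thesis by simp
qed

lemma summable_power_square:
  fixes z q :: real
  assumes "0 < q" "q < 1"
  shows "summable (\<lambda>n. \<bar>z ^ n * q ^ (n * n)\<bar>)"
proof -
  have "(\<lambda>n. \<bar>z\<bar> * q ^ (2 * n + 1)) \<longlonglongrightarrow> \<bar>z\<bar> * (0 * q)"
    unfolding power_add power_mult power_one_right
    using assms by (intro tendsto_intros LIMSEQ_realpow_zero) (auto simp: power_less_one_iff)
  then have "eventually (\<lambda>n. \<bar>z\<bar> * q ^ (2 * n + 1) < 1/2) sequentially"
    by (intro order_tendstoD(2)) auto
  then obtain N where N: "\<bar>z\<bar> * q ^ (2 * n + 1) < 1/2" if "n \<ge> N" for n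
    by (auto simp: eventually_at_top_linorder)
  show ?thesis
  proof (rule summable_ratio_test[of "1/2" N])
    fix n assume n: "n \<ge> N"
    have "\<bar>z ^ Suc n * q ^ (Suc n * Suc n)\<bar> = (\<bar>z\<bar> * q ^ (2 * n + 1)) * \<bar>z ^ n * q ^ (n * n)\<bar>"
      using assms by (simp add: abs_mult power_add power2_eq_square power_abs mult_2)
    also have "\<dots> \<le> 1/2 * \<bar>z ^ n * q ^ (n * n)\<bar>"
      using N[OF n] by (intro mult_right_mono) auto
    finally show "norm \<bar>z ^ Suc n * q ^ (Suc n * Suc n)\<bar> \<le> 1/2 * norm \<bar>z ^ n * q ^ (n * n)\<bar>"
      by simp
  qed auto
qed

text \<open>Keeping the variable \<open>z\<close> makes one series serve for all three theta constants: \<open>z = 1\<close> and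
  \<open>z = -1\<close> give \<open>\<theta>\<^sub>3\<close> and \<open>\<theta>\<^sub>4\<close>, and \<open>z = q\<close> gives \<open>\<theta>\<^sub>2\<close> without its factor \<open>q\<^sup>1\<^sup>/\<^sup>4\<close>. All exponents stay
  integral.\<close>

definition theta :: "real \<Rightarrow> real \<Rightarrow> real" where
  "theta z q = (\<Sum>\<^sub>\<infinity>n::int. z powi n * q powi n\<^sup>2)"

lemma theta_summable:
  fixes z q :: real
  assumes "0 < q" "q < 1"
  shows "(\<lambda>n::int. z powi n * q powi n\<^sup>2) summable_on UNIV"
proof (rule summable_on_intI)
  have sq: "q powi (int n)\<^sup>2 = q ^ (n * n)" for n
    by (metis of_nat_mult power2_eq_square power_int_of_nat)
  show "summable (\<lambda>n. \<bar>z powi int n * q powi (int n)\<^sup>2\<bar>)"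
    using summable_power_square[OF assms, of z] by (simp add: sq)
  show "summable (\<lambda>n. \<bar>z powi (- int n) * q powi (- int n)\<^sup>2\<bar>)"
    using summable_power_square[OF assms, of "inverse z"]
    by (simp add: sq power_int_minus power_inverse)
qed

lemma theta_has_sum:
  assumes "0 < q" "q < 1"
  shows "((\<lambda>n::int. z powi n * q powi n\<^sup>2) has_sum theta z q) UNIV"
  unfolding theta_def using theta_summable[OF assms] by simp

text \<open>Completing the square, \<open>n\<^sup>2 + 2mn = (n + m)\<^sup>2 - m\<^sup>2\<close>, followed by the shift \<open>n \<mapsto> n + m\<close>. For
  \<open>z = 1\<close> and \<open>z = q\<close> these are the series with exponents \<open>n\<^sup>2 + 2mn\<close> and \<open>n\<^sup>2 + (2m+1)n\<close>.\<close>

lemma theta_shift_has_sum: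
  assumes "0 < q" "q < 1" "z \<noteq> 0"
  shows "((\<lambda>n::int. z powi n * q powi (n\<^sup>2 + 2 * m * n)) has_sum
          (z powi (- m) * q powi (- m\<^sup>2) * theta z q)) UNIV"
proof -
  have "((\<lambda>n::int. z powi (n + m) * q powi (n + m)\<^sup>2) has_sum theta z q) UNIV"
    by (subst has_sum_reindex_bij_witness[where i = "\<lambda>n. n - m" and j = "\<lambda>n. n + m" and T = UNIV])
       (auto intro: theta_has_sum[OF assms(1,2)])
  then have "((\<lambda>n::int. z powi (- m) * q powi (- m\<^sup>2) * (z powi (n + m) * q powi (n + m)\<^sup>2)) has_sum
          (z powi (- m) * q powi (- m\<^sup>2) * theta z q)) UNIV"
    by (rule has_sum_cmult_right)
  moreover have "z powi (- m) * q powi (- m\<^sup>2) * (z powi (n + m) * q powi (n + m)\<^sup>2) =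
                 z powi n * q powi (n\<^sup>2 + 2 * m * n)" for n
  proof -
    have "z powi n = z powi (- m) * z powi (n + m)"
      using assms by (subst power_int_add[symmetric]) auto
    moreover have "q powi (n\<^sup>2 + 2 * m * n) = q powi (- m\<^sup>2) * q powi (n + m)\<^sup>2"
      using assms by (subst power_int_add[symmetric]) (auto simp: power2_eq_square algebra_simps)
    ultimately show ?thesis by simp
  qed
  ultimately show ?thesis by simp
qed

lemma theta_quasi_periodic:
  assumes "0 < q" "q < 1" "z \<noteq> 0"
  shows "theta (z * q\<^sup>2) q = theta z q / (z * q)"
proof -
  have "(\<lambda>n. (z * q\<^sup>2) powi n * q powi n\<^sup>2) = (\<lambda>n. z powi n * q powi (n\<^sup>2 + 2 * 1 * n))"
  proof
    fix n :: int
    have "(q\<^sup>2) powi n = q powi (2 * n)"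
      by (simp add: power_int_mult)
    then show "(z * q\<^sup>2) powi n * q powi n\<^sup>2 = z powi n * q powi (n\<^sup>2 + 2 * 1 * n)"
      using assms by (simp add: power_int_mult_distrib power_int_add)
  qed
  then have "theta (z * q\<^sup>2) q = z powi (-1) * q powi (- 1\<^sup>2) * theta z q"
    using theta_shift_has_sum[OF assms, of 1] unfolding theta_def[of "z * q\<^sup>2"]
    by (simp add: infsumI)
  then show ?thesis
    using assms by (simp add: power_int_minus field_simps)
qed

text \<open>The map \<open>(i, j) \<mapsto> (i + j, i - j)\<close> is a bijection from the integer lattice onto the pairs with even
  coordinate sum; shifting the first coordinate by one covers the odd pairs. It diagonalises
  \<open>m\<^sup>2 + n\<^sup>2\<close> as \<open>2i\<^sup>2 + 2j\<^sup>2\<close>, which is what doubles the exponent of the nome.\<close>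

lemma has_sum_int_pairs_by_parity:
  fixes f :: "int \<times> int \<Rightarrow> real"
  assumes "((\<lambda>(i, j). f (i + j, i - j)) has_sum a) UNIV"
    and "((\<lambda>(i, j). f (i + j + 1, i - j)) has_sum b) UNIV"
  shows "(f has_sum (a + b)) UNIV"
proof -
  define E where "E = {(m :: int, n). even (m + n)}"
  have "((\<lambda>(i, j). f (i + j, i - j)) has_sum a) UNIV = (f has_sum a) E"
    by (rule has_sum_reindex_bij_witness[where i = "\<lambda>(m, n). ((m + n) div 2, (m - n) div 2)"
          and j = "\<lambda>(i, j). (i + j, i - j)"])
       (auto simp: E_def, presburger+)
  moreover have "((\<lambda>(i, j). f (i + j + 1, i - j)) has_sum b) UNIV = (f has_sum b) (- E)"
    by (rule has_sum_reindex_bij_witness[where i = "\<lambda>(m, n). ((m + n - 1) div 2, (m - n - 1) div 2)"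
          and j = "\<lambda>(i, j). (i + j + 1, i - j)"])
       (auto simp: E_def, presburger+)
  ultimately have "(f has_sum (a + b)) (E \<union> - E)"
    using assms by (intro has_sum_Un_disjoint) auto
  then show ?thesis by simp
qed

lemma has_sum_product_real:
  fixes f :: "'a \<Rightarrow> real" and g :: "'b \<Rightarrow> real"
  assumes "(f has_sum a) A" and "(g has_sum b) B"
  shows "((\<lambda>(x, y). f x * g y) has_sum (a * b)) (A \<times> B)"
proof (rule has_sum_SigmaI)
  show "((\<lambda>y. case (x, y) of (x, y) \<Rightarrow> f x * g y) has_sum (f x * b)) B" for x
    using assms(2) by (auto intro: has_sum_cmult_right)
  show "((\<lambda>x. f x * b) has_sum (a * b)) A"
    using assms(1) by (rule has_sum_cmult_left)
  have f: "(\<lambda>x. \<bar>f x\<bar>) summable_on A" and g: "(\<lambda>y. \<bar>g y\<bar>) summable_on B"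
    using assms summable_on_iff_abs_summable_on_real[of f A] summable_on_iff_abs_summable_on_real[of g B]
    by (auto simp: summable_on_def)
  have "(\<lambda>(x, y). \<bar>f x\<bar> * \<bar>g y\<bar>) summable_on (A \<times> B)"
  proof (rule summable_on_SigmaI)
    show "((\<lambda>y. case (x, y) of (x, y) \<Rightarrow> \<bar>f x\<bar> * \<bar>g y\<bar>) has_sum (\<bar>f x\<bar> * (\<Sum>\<^sub>\<infinity>y\<in>B. \<bar>g y\<bar>))) B" for x
      using g by (auto intro!: has_sum_cmult_right)
    show "(\<lambda>x. \<bar>f x\<bar> * (\<Sum>\<^sub>\<infinity>y\<in>B. \<bar>g y\<bar>)) summable_on A"
      using f by (rule summable_on_cmult_left)
  qed auto
  then have "(\<lambda>p. norm (case p of (x, y) \<Rightarrow> f x * g y)) summable_on (A \<times> B)"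
    by (simp add: case_prod_unfold abs_mult)
  then show "(\<lambda>(x, y). f x * g y) summable_on (A \<times> B)"
    by (rule abs_summable_summable)
qed

text \<open>The common source of the duplication formulas below: sum \<open>z^m w^n q^(m^2 + n^2)\<close> over the
  lattice, separately over the two parity classes of \<open>m + n\<close>.\<close>

theorem theta_mult:
  assumes "0 < q" "q < 1" "z \<noteq> 0" "w \<noteq> 0"
  shows "theta z q * theta w q = theta (z * w) (q\<^sup>2) * theta (z / w) (q\<^sup>2) +
           z * q * theta (z * w * q\<^sup>2) (q\<^sup>2) * theta (z / w * q\<^sup>2) (q\<^sup>2)"
proof -
  define f where "f = (\<lambda>(m, n). z powi m * q powi m\<^sup>2 * (w powi n * q powi n\<^sup>2))"
  have q2: "0 < q\<^sup>2" "q\<^sup>2 < 1"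
    using assms by (auto simp: power_less_one_iff)
  have qq: "(q\<^sup>2) powi n = q powi (2 * n)" for n
    by (simp add: power_int_mult)
  have "(f has_sum (theta z q * theta w q)) UNIV"
    unfolding f_def UNIV_Times_UNIV[symmetric]
    using assms by (intro has_sum_product_real theta_has_sum)
  moreover have "(f has_sum (theta (z * w) (q\<^sup>2) * theta (z / w) (q\<^sup>2) +
      z * q * (theta (z * w * q\<^sup>2) (q\<^sup>2) * theta (z / w * q\<^sup>2) (q\<^sup>2)))) UNIV"
  proof (rule has_sum_int_pairs_by_parity)
    have zw: "z powi (i + j) * w powi (i - j) = (z * w) powi i * (z / w) powi j" for i j
      using assms
      by (simp add: power_int_add power_int_diff power_int_mult_distrib power_int_divide_distrib)
    have 1: "f (i + j, i - j) =
        (z * w) powi i * (q\<^sup>2) powi i\<^sup>2 * ((z / w) powi j * (q\<^sup>2) powi j\<^sup>2)" for i j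
    proof -
      have "q powi (i + j)\<^sup>2 * q powi (i - j)\<^sup>2 = (q\<^sup>2) powi i\<^sup>2 * (q\<^sup>2) powi j\<^sup>2"
        unfolding qq using assms
        by (simp add: power_int_add[symmetric] power2_eq_square algebra_simps)
      then show ?thesis
        unfolding f_def using zw[of i j] by (simp add: mult_ac)
    qed
    have 2: "f (i + j + 1, i - j) = z * q *
        ((z * w * q\<^sup>2) powi i * (q\<^sup>2) powi i\<^sup>2 * ((z / w * q\<^sup>2) powi j * (q\<^sup>2) powi j\<^sup>2))" for i j
    proof -
      have q: "q powi (i + j + 1)\<^sup>2 * q powi (i - j)\<^sup>2 =
            q * ((q\<^sup>2) powi i * (q\<^sup>2) powi i\<^sup>2 * ((q\<^sup>2) powi j * (q\<^sup>2) powi j\<^sup>2))" (is "?l = ?r")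
      proof -
        have "?l = q powi (1 + (2 * i + 2 * i\<^sup>2 + (2 * j + 2 * j\<^sup>2)))"
          using assms by (simp add: power_int_add[symmetric] power2_eq_square algebra_simps)
        also have "\<dots> = ?r"
          unfolding qq using assms by (simp add: power_int_add)
        finally show ?thesis .
      qed
      have "z powi (i + j + 1) = z * z powi (i + j)"
        using assms by (simp add: power_int_add)
      then have "f (i + j + 1, i - j) = z * (z powi (i + j) * w powi (i - j)) *
          (q powi (i + j + 1)\<^sup>2 * q powi (i - j)\<^sup>2)"
        unfolding f_def by (simp add: mult_ac)
      then show ?thesis
        unfolding q zw by (simp only: power_int_mult_distrib mult_ac)
    qed
    show "((\<lambda>(i, j). f (i + j, i - j)) has_sum
        (theta (z * w) (q\<^sup>2) * theta (z / w) (q\<^sup>2))) UNIV"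
      unfolding 1 UNIV_Times_UNIV[symmetric]
      by (intro has_sum_product_real theta_has_sum q2)
    show "((\<lambda>(i, j). f (i + j + 1, i - j)) has_sum
        (z * q * (theta (z * w * q\<^sup>2) (q\<^sup>2) * theta (z / w * q\<^sup>2) (q\<^sup>2)))) UNIV"
      unfolding 2 case_prod_unfold
      using has_sum_cmult_right[OF has_sum_product_real[OF theta_has_sum[OF q2] theta_has_sum[OF q2]]]
      by (simp add: case_prod_unfold)
  qed
  ultimately show ?thesis
    by (auto dest: has_sum_unique simp: mult.assoc)
qed

section \<open>The Jacobi triple product\<close>

definition qfac :: "real \<Rightarrow> nat \<Rightarrow> real" where
  "qfac p n = (\<Prod>j<n. 1 - p ^ (j + 1))"

text \<open>The reciprocal of a \<open>q\<close>-factorial, extended by zero to negative arguments like \<open>1/n!\<close>. With this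
  convention the recursion \<open>inv_qfac_pred\<close> holds at every integer, so that the induction
  for the finite triple product has no boundary cases.\<close>

definition inv_qfac :: "real \<Rightarrow> int \<Rightarrow> real" where
  "inv_qfac p i = (if i < 0 then 0 else 1 / qfac p (nat i))"

text \<open>The Gaussian binomial coefficient \<open>2n\<close> over \<open>n + k\<close> with base \<open>p\<close>; it vanishes for \<open>|k| > n\<close>.\<close>

definition central_qbinomial :: "real \<Rightarrow> nat \<Rightarrow> int \<Rightarrow> real" where
  "central_qbinomial p n k = qfac p (2 * n) * inv_qfac p (int n - k) * inv_qfac p (int n + k)"

lemma qfac_pos: "0 < p \<Longrightarrow> p < 1 \<Longrightarrow> 0 < qfac p n"
  unfolding qfac_def by (intro prod_pos) (auto simp: power_less_one_iff simp del: power_Suc)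

lemma inv_qfac_pred:
  assumes "0 < p" "p < 1"
  shows "inv_qfac p (i - 1) = (1 - p powi i) * inv_qfac p i"
proof -
  consider "i < 0" | "i = 0" | "i > 0" by linarith
  then show ?thesis
  proof cases
    case 3
    then obtain n where i: "i = int (Suc n)"
      using zero_less_imp_eq_int[OF 3] by (metis Suc_pred)
    have "p powi i = p ^ Suc n"
      unfolding i by (rule power_int_of_nat)
    moreover have "qfac p (Suc n) = qfac p n * (1 - p ^ Suc n)"
      by (simp add: qfac_def)
    moreover have "p ^ Suc n < 1"
      using assms by (simp add: power_less_one_iff del: power_Suc)
    ultimately show ?thesis
      using i by (simp add: inv_qfac_def nat_add_distrib del: power_Suc)
  qed (auto simp: inv_qfac_def)
qed

text \<open>Multiplying the expansion for \<open>n\<close> by \<open>(1 + zQ)(1 + Q/z)\<close> with \<open>Q = q\<^sup>2\<^sup>n\<^sup>+\<^sup>1\<close> combines three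
  neighbouring coefficients. That they add up to the next coefficient is, after the recursion for
  reciprocal \<open>q\<close>-factorials, the polynomial identity \<open>poly\<close> in
  \<open>a = p^(n+1-k)\<close> and \<open>b = p^(n+1+k)\<close>; the products \<open>Q q^(1-2k) = a\<close> and \<open>Q q^(1+2k) = b\<close> arise from
  shifting the square \<open>k\<^sup>2\<close> by one.\<close>

lemma finite_triple_product:
  fixes z q :: real
  assumes "0 < q" "q < 1" "z \<noteq> 0"
  shows "((\<lambda>k::int. z powi k * q powi k\<^sup>2 * central_qbinomial (q\<^sup>2) n k) has_sum
          (\<Prod>j<n. (1 + z * q ^ (2 * j + 1)) * (1 + q ^ (2 * j + 1) / z))) UNIV"
proof (induction n)
  case 0
  have "inv_qfac (q\<^sup>2) (- k) * inv_qfac (q\<^sup>2) k = 0" if "k \<noteq> 0" for k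
    using that by (auto simp: inv_qfac_def)
  then show ?case
    by (intro has_sum_finite_neutralI[where B = "{0}"])
       (auto simp: central_qbinomial_def inv_qfac_def qfac_def)
next
  case (Suc n)
  define p where "p = q\<^sup>2"
  define Q where "Q = q ^ (2 * n + 1)"
  define T where "T = (\<lambda>k::int. z powi k * q powi k\<^sup>2 * central_qbinomial p n k)"
  define S where "S = (\<Prod>j<n. (1 + z * q ^ (2 * j + 1)) * (1 + q ^ (2 * j + 1) / z))"
  have p: "0 < p" "p < 1"
    using assms by (auto simp: p_def power_less_one_iff)
  have T: "(T has_sum S) UNIV"
    using Suc.IH by (simp add: T_def S_def p_def)
  have Tm: "((\<lambda>k. T (k - 1)) has_sum S) UNIV"
    by (subst has_sum_reindex_bij_witness[where i = "\<lambda>n. n + 1" and j = "\<lambda>n. n - 1" and T = UNIV])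
       (auto intro: T)
  have Tp: "((\<lambda>k. T (k + 1)) has_sum S) UNIV"
    by (subst has_sum_reindex_bij_witness[where i = "\<lambda>n. n - 1" and j = "\<lambda>n. n + 1" and T = UNIV])
       (auto intro: T)
  have "((\<lambda>k. (1 + Q\<^sup>2) * T k + (z * Q) * T (k - 1) + (Q / z) * T (k + 1)) has_sum
      ((1 + Q\<^sup>2) * S + (z * Q) * S + (Q / z) * S)) UNIV"
    by (intro has_sum_add has_sum_cmult_right T Tm Tp)
  moreover have "(1 + Q\<^sup>2) * S + (z * Q) * S + (Q / z) * S = S * ((1 + z * Q) * (1 + Q / z))"
    using assms by (simp add: field_simps power2_eq_square)
  moreover have "(1 + Q\<^sup>2) * T k + (z * Q) * T (k - 1) + (Q / z) * T (k + 1) =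
      z powi k * q powi k\<^sup>2 * central_qbinomial p (Suc n) k" for k
  proof -
    define a where "a = p powi (int n + 1 - k)"
    define b where "b = p powi (int n + 1 + k)"
    define A where "A = inv_qfac p (int n + 1 - k)"
    define B where "B = inv_qfac p (int n + 1 + k)"
    define M where "M = z powi k * q powi k\<^sup>2"
    note rec = inv_qfac_pred[OF p]
    have pq: "p powi i = q powi (2 * i)" for i
      by (simp add: p_def power_int_mult)
    have qn: "q ^ i = q powi (int i)" for i
      by simp
    have w1: "inv_qfac p (int n - k) = (1 - a) * A" "inv_qfac p (int n + k) = (1 - b) * B"
      using rec[of "int n + 1 - k"] rec[of "int n + 1 + k"]
      by (simp_all add: a_def b_def A_def B_def algebra_simps)
    have "p powi (int n - k) = a / p" "p powi (int n + k) = b / p"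
      using p by (simp_all add: a_def b_def power_int_add power_int_diff)
    then have w2: "inv_qfac p (int n - (k + 1)) = (1 - a / p) * ((1 - a) * A)"
      "inv_qfac p (int n + (k - 1)) = (1 - b / p) * ((1 - b) * B)"
      using rec[of "int n - k"] rec[of "int n + k"] w1 by (simp_all only: diff_diff_eq add_diff_eq)
    have w3: "inv_qfac p (int n - (k - 1)) = A" "inv_qfac p (int n + (k + 1)) = B"
      by (simp_all add: A_def B_def algebra_simps)
    have ab: "a * b = p ^ (2 * n + 2)"
    proof -
      have "a * b = p powi int (2 * n + 2)"
        unfolding a_def b_def using p by (subst power_int_add[symmetric]) (auto simp: add_ac)
      then show ?thesis by (simp only: power_int_of_nat)
    qed
    have Q2: "Q\<^sup>2 = a * b / p"
      unfolding ab using assms by (simp add: Q_def p_def power_mult[symmetric] field_simps power_add[symmetric])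
    have P: "qfac p (2 * Suc n) = qfac p (2 * n) * ((1 - a * b / p) * (1 - a * b))"
      unfolding ab using p by (simp add: qfac_def mult_ac)
    have zm: "z * Q * (z powi (k - 1) * q powi (k - 1)\<^sup>2) = a * M"
    proof -
      have "z * z powi (k - 1) = z powi k"
        using assms by (simp add: power_int_diff)
      moreover have "Q * q powi (k - 1)\<^sup>2 = a * q powi k\<^sup>2"
        unfolding Q_def a_def pq qn using assms
        by (subst power_int_add[symmetric]; simp add: power_int_add[symmetric] power2_eq_square algebra_simps)
      ultimately show ?thesis
        unfolding M_def by (metis (no_types, opaque_lifting) mult.assoc mult.commute)
    qed
    have zp: "Q / z * (z powi (k + 1) * q powi (k + 1)\<^sup>2) = b * M"
    proof -
      have "z powi (k + 1) / z = z powi k"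
        using assms by (simp add: power_int_add)
      moreover have "Q * q powi (k + 1)\<^sup>2 = b * q powi k\<^sup>2"
        unfolding Q_def b_def pq qn using assms
        by (subst power_int_add[symmetric]; simp add: power_int_add[symmetric] power2_eq_square algebra_simps)
      ultimately show ?thesis
        unfolding M_def by (metis (no_types, opaque_lifting) mult.assoc mult.commute times_divide_eq_left times_divide_eq_right)
    qed
    define W where "W = M * qfac p (2 * n) * A * B"
    have "(z * Q) * T (k - 1) = a * M * (qfac p (2 * n) * A * ((1 - b / p) * ((1 - b) * B)))"
      unfolding T_def central_qbinomial_def w2 w3 zm[symmetric] by (simp only: mult_ac)
    then have T1: "(z * Q) * T (k - 1) = W * (a * ((1 - b / p) * (1 - b)))"
      unfolding W_def by (simp only: mult_ac)
    have "(Q / z) * T (k + 1) = b * M * (qfac p (2 * n) * ((1 - a / p) * ((1 - a) * A)) * B)"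
      unfolding T_def central_qbinomial_def w2 w3 zp[symmetric] by (simp only: mult_ac)
    then have T2: "(Q / z) * T (k + 1) = W * (b * ((1 - a / p) * (1 - a)))"
      unfolding W_def by (simp only: mult_ac)
    have T3: "T k = W * ((1 - a) * (1 - b))"
      unfolding T_def central_qbinomial_def w1 M_def[symmetric] W_def by (simp only: mult_ac)
    have new: "z powi k * q powi k\<^sup>2 * central_qbinomial p (Suc n) k =
        W * ((1 - a * b / p) * (1 - a * b))"
      unfolding central_qbinomial_def P M_def W_def A_def B_def by (simp add: add.commute mult_ac)
    have poly: "(1 + a * b / p) * ((1 - a) * (1 - b)) + a * ((1 - b / p) * (1 - b)) +
        b * ((1 - a / p) * (1 - a)) = (1 - a * b / p) * (1 - a * b)"
      using p by (simp add: field_simps)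
    show ?thesis
      unfolding T1 T2 T3 new Q2 poly[symmetric]
      by (simp only: distrib_left mult.left_commute[of "1 + a * b / p" W])
  qed
  ultimately show ?case
    by (simp add: S_def Q_def p_def)
qed

lemma prod_one_plus_limit_pos:
  fixes x :: "nat \<Rightarrow> real"
  assumes "summable (\<lambda>j. \<bar>x j\<bar>)" and "\<And>j. -1 < x j"
  obtains L where "0 < L" "(\<lambda>n. \<Prod>j<n. 1 + x j) \<longlonglongrightarrow> L"
proof -
  have pos: "1 + x j > 0" for j
    using assms(2)[of j] by simp
  have cp: "convergent_prod (\<lambda>j. 1 + x j)"
    using assms(1)
    by (intro abs_convergent_prod_imp_convergent_prod summable_imp_abs_convergent_prod) simp
  have lim: "(\<lambda>n. \<Prod>j<n. 1 + x j) \<longlonglongrightarrow> (\<Prod>j. 1 + x j)"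
    using convergent_prod_LIMSEQ[OF cp] by (subst LIMSEQ_lessThan_iff_atMost) simp
  have "(\<Prod>j. 1 + x j) \<noteq> 0"
    using pos by (intro prodinf_nonzero[OF cp]) (metis less_irrefl)
  moreover have "0 \<le> (\<Prod>j. 1 + x j)"
    by (intro LIMSEQ_le_const[OF lim] exI allI impI prod_nonneg less_imp_le pos)
  ultimately show thesis
    using lim by (intro that) auto
qed

lemma qfac_limit:
  assumes "0 < p" "p < 1"
  obtains L where "0 < L" "qfac p \<longlonglongrightarrow> L" "\<And>n. L \<le> qfac p n"
proof -
  have "summable (\<lambda>j. p * p ^ j)"
    using assms by (intro summable_mult summable_geometric) auto
  then obtain L where L: "0 < L" "(\<lambda>n. \<Prod>j<n. 1 + - (p ^ (j + 1))) \<longlonglongrightarrow> L"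
    using assms by (elim prod_one_plus_limit_pos[of "\<lambda>j. - (p ^ (j + 1))", rotated 2])
      (auto simp: power_less_one_iff simp flip: power_Suc)
  then have lim: "qfac p \<longlonglongrightarrow> L"
    by (simp add: qfac_def[abs_def])
  have "decseq (qfac p)"
  proof (rule decseq_SucI)
    show "qfac p (Suc n) \<le> qfac p n" for n
      using mult_left_mono[of "1 - p ^ (n + 1)" 1 "qfac p n"] qfac_pos[OF assms, of n] assms
      by (simp add: qfac_def)
  qed
  from decseq_ge[OF this lim] show thesis
    using L(1) lim that by blast
qed

text \<open>Tannery's theorem, transported from the natural numbers to the integers by an enumeration.\<close>

lemma infsum_int_dominated_limit:
  fixes f :: "nat \<Rightarrow> int \<Rightarrow> real"
  assumes lim: "\<And>k. (\<lambda>n. f n k) \<longlonglongrightarrow> g k"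
    and bound: "\<And>n k. \<bar>f n k\<bar> \<le> h k" and "h summable_on UNIV"
  shows "(\<lambda>n. infsum (f n) UNIV) \<longlonglongrightarrow> infsum g UNIV"
proof -
  have bij: "bij_betw int_decode UNIV UNIV"
    by (rule bij_int_decode)
  have h: "summable (\<lambda>i. h (int_decode i))"
    using assms(3) summable_on_reindex_bij_betw[OF bij, of h] by (auto intro: summable_on_imp_summable)
  have eq: "infsum u UNIV = (\<Sum>i. u (int_decode i))" if "\<And>k. \<bar>u k\<bar> \<le> h k" for u
  proof -
    have "summable (\<lambda>i. norm (u (int_decode i)))"
      using that by (intro summable_comparison_test[OF _ h]) auto
    then have "(\<lambda>i. u (int_decode i)) summable_on UNIV"
      by (rule norm_summable_imp_summable_on)
    then have "(\<lambda>i. u (int_decode i)) sums (\<Sum>\<^sub>\<infinity>i. u (int_decode i))"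
      by (intro has_sum_imp_sums) simp
    then show ?thesis
      using infsum_reindex_bij_betw[OF bij, of u] by (simp add: sums_unique)
  qed
  have g: "\<bar>g k\<bar> \<le> h k" for k
    using tendsto_rabs[OF lim] by (rule LIMSEQ_le_const2) (use bound in auto)
  have "(\<lambda>n. \<Sum>i. f n (int_decode i)) \<longlonglongrightarrow> (\<Sum>i. g (int_decode i))"
    using tannerys_theorem[where a = "\<lambda>i n. f n (int_decode i)" and F = sequentially, OF lim _ h] bound
    by (auto simp: case_prod_unfold)
  then show ?thesis
    by (simp add: eq[OF bound] eq[OF g])
qed

text \<open>Since \<open>(p;p)\<^sub>n\<close> has a positive limit \<open>L\<close>, each central \<open>q\<close>-binomial coefficient tends to \<open>1/L\<close> and all
  are bounded by \<open>1/L\<^sup>2\<close>, so the limit of the finite triple product may be taken term by term. Partial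
  products are kept in the statement because the later applications regroup factors at finite level.\<close>

theorem jacobi_triple_product:
  fixes z q :: real
  assumes "0 < q" "q < 1" "z \<noteq> 0"
  shows "(\<lambda>n. qfac (q\<^sup>2) n * (\<Prod>j<n. (1 + z * q ^ (2 * j + 1)) * (1 + q ^ (2 * j + 1) / z)))
           \<longlonglongrightarrow> theta z q"
proof -
  define p where "p = q\<^sup>2"
  have p: "0 < p" "p < 1"
    using assms by (auto simp: p_def power_less_one_iff)
  obtain L where L: "0 < L" "qfac p \<longlonglongrightarrow> L" "\<And>n. L \<le> qfac p n"
    using qfac_limit[OF p] by blast
  have qfac_le: "qfac p n \<le> 1" for n
    unfolding qfac_def using p by (intro prod_le_1) (auto simp: power_le_one simp del: power_Suc)
  have w: "0 \<le> inv_qfac p i" "inv_qfac p i \<le> 1 / L" for i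
    using L qfac_pos[OF p]
    by (auto simp: inv_qfac_def less_imp_le[OF qfac_pos[OF p]] intro!: divide_left_mono)
  have c_bound: "\<bar>central_qbinomial p n k\<bar> \<le> 1 * (1 / L) * (1 / L)" for n k
    unfolding central_qbinomial_def abs_mult
    using w L(1) qfac_pos[OF p, of "2 * n"] qfac_le[of "2 * n"] by (intro mult_mono) auto
  have w_lim: "(\<lambda>n. inv_qfac p (int n + k)) \<longlonglongrightarrow> 1 / L" for k
  proof -
    have "filterlim (\<lambda>n. nat (int n + k)) at_top sequentially"
      by (rule filterlim_at_top_mono[OF filterlim_minus_const_nat_at_top[of "nat \<bar>k\<bar>"]])
        (auto intro!: always_eventually)
    then have "(\<lambda>n. 1 / qfac p (nat (int n + k))) \<longlonglongrightarrow> 1 / L"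
      using L by (intro tendsto_intros filterlim_compose[OF L(2)]) auto
    moreover have "eventually (\<lambda>n. 1 / qfac p (nat (int n + k)) = inv_qfac p (int n + k)) sequentially"
      using eventually_ge_at_top[of "nat \<bar>k\<bar>"] by eventually_elim (auto simp: inv_qfac_def)
    ultimately show ?thesis
      by (rule Lim_transform_eventually)
  qed
  have "filterlim (\<lambda>n. 2 * n) at_top (sequentially :: nat filter)"
    by (auto intro!: filterlim_subseq simp: strict_mono_def)
  then have P2: "(\<lambda>n. qfac p (2 * n)) \<longlonglongrightarrow> L"
    by (rule filterlim_compose[OF L(2)])
  have c_lim: "(\<lambda>n. central_qbinomial p n k) \<longlonglongrightarrow> L * (1 / L) * (1 / L)" for k
    unfolding central_qbinomial_def
    using w_lim[of k] w_lim[of "-k"] by (intro tendsto_mult P2) auto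
  have "(\<lambda>n. \<Sum>\<^sub>\<infinity>k. z powi k * q powi k\<^sup>2 * central_qbinomial p n k)
      \<longlonglongrightarrow> (\<Sum>\<^sub>\<infinity>k. z powi k * q powi k\<^sup>2 * (L * (1 / L) * (1 / L)))"
  proof (rule infsum_int_dominated_limit)
    show "(\<lambda>n. z powi k * q powi k\<^sup>2 * central_qbinomial p n k)
        \<longlonglongrightarrow> z powi k * q powi k\<^sup>2 * (L * (1 / L) * (1 / L))" for k
      by (intro tendsto_mult_left c_lim)
    show "\<bar>z powi k * q powi k\<^sup>2 * central_qbinomial p n k\<bar>
        \<le> \<bar>z powi k * q powi k\<^sup>2\<bar> * (1 * (1 / L) * (1 / L))" for n k
      unfolding abs_mult[of _ "central_qbinomial p n k"] using c_bound
      by (intro mult_left_mono) auto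
    show "(\<lambda>k. \<bar>z powi k * q powi k\<^sup>2\<bar> * (1 * (1 / L) * (1 / L))) summable_on UNIV"
      using theta_summable[OF assms(1,2), of z]
      unfolding summable_on_iff_abs_summable_on_real[of "\<lambda>k. z powi k * q powi k\<^sup>2"] real_norm_def
      by (rule summable_on_cmult_left)
  qed
  moreover have "(\<Sum>\<^sub>\<infinity>k. z powi k * q powi k\<^sup>2 * central_qbinomial p n k) =
      (\<Prod>j<n. (1 + z * q ^ (2 * j + 1)) * (1 + q ^ (2 * j + 1) / z))" for n
    using finite_triple_product[OF assms] unfolding p_def by (rule infsumI)
  moreover have "(\<Sum>\<^sub>\<infinity>k. z powi k * q powi k\<^sup>2 * (L * (1 / L) * (1 / L))) = theta z q / L"
    using L unfolding theta_def by (subst infsum_cmult_left') (simp add: field_simps)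
  ultimately have "(\<lambda>n. \<Prod>j<n. (1 + z * q ^ (2 * j + 1)) * (1 + q ^ (2 * j + 1) / z))
      \<longlonglongrightarrow> theta z q / L"
    by simp
  from tendsto_mult[OF L(2) this] show ?thesis
    using L by (simp add: p_def)
qed

section \<open>Gauss's integral and the arithmetic-geometric mean\<close>

text \<open>The symmetric form \<open>I(a, b)\<close> of the complete elliptic integral: \<open>K(k) = I(1, k')\<close> and
  \<open>K(k') = I(1, k)\<close>, so both periods are values of one function.\<close>

definition gauss_integral :: "real \<Rightarrow> real \<Rightarrow> real" where
  "gauss_integral a b = integral {0..pi/2} (\<lambda>t. 1 / sqrt (a\<^sup>2 * (cos t)\<^sup>2 + b\<^sup>2 * (sin t)\<^sup>2))"

lemma gauss_form_pos:
  fixes a b t :: real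
  assumes "a \<noteq> 0" "b \<noteq> 0"
  shows "0 < a\<^sup>2 * (cos t)\<^sup>2 + b\<^sup>2 * (sin t)\<^sup>2"
proof (cases "cos t = 0")
  case True
  then have "(sin t)\<^sup>2 = 1"
    using sin_cos_squared_add[of t] by simp
  then show ?thesis using assms True by simp
next
  case False
  then show ?thesis using assms by (intro add_pos_nonneg) auto
qed

lemma gauss_integrand_continuous:
  fixes a b :: real
  assumes "a \<noteq> 0" "b \<noteq> 0"
  shows "continuous_on S (\<lambda>t. 1 / sqrt (a\<^sup>2 * (cos t)\<^sup>2 + b\<^sup>2 * (sin t)\<^sup>2))"
  using gauss_form_pos[OF assms] by (intro continuous_intros) (auto simp: less_le)

lemma gauss_integrand_integrable:
  fixes a b :: real
  assumes "a \<noteq> 0" "b \<noteq> 0"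
  shows "(\<lambda>t. 1 / sqrt (a\<^sup>2 * (cos t)\<^sup>2 + b\<^sup>2 * (sin t)\<^sup>2)) integrable_on {c..d}"
  by (intro integrable_continuous_real gauss_integrand_continuous assms)

lemma gauss_integral_scale:
  assumes "0 < c"
  shows "gauss_integral (c * a) (c * b) = gauss_integral a b / c"
proof -
  have "sqrt ((c * a)\<^sup>2 * (cos t)\<^sup>2 + (c * b)\<^sup>2 * (sin t)\<^sup>2) =
      c * sqrt (a\<^sup>2 * (cos t)\<^sup>2 + b\<^sup>2 * (sin t)\<^sup>2)" for t
  proof -
    have "(c * a)\<^sup>2 * (cos t)\<^sup>2 + (c * b)\<^sup>2 * (sin t)\<^sup>2 = c\<^sup>2 * (a\<^sup>2 * (cos t)\<^sup>2 + b\<^sup>2 * (sin t)\<^sup>2)"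
      by (simp add: power_mult_distrib distrib_left)
    then show ?thesis using assms by (simp add: real_sqrt_mult)
  qed
  then have "gauss_integral (c * a) (c * b) =
      integral {0..pi/2} (\<lambda>t. (1 / c) * (1 / sqrt (a\<^sup>2 * (cos t)\<^sup>2 + b\<^sup>2 * (sin t)\<^sup>2)))"
    unfolding gauss_integral_def by simp
  then show ?thesis
    unfolding gauss_integral_def by (subst (asm) integral_mult_right) simp
qed

lemma gauss_integral_bounds:
  assumes "0 < m" "m \<le> a" "m \<le> b" "a \<le> M" "b \<le> M"
  shows "gauss_integral a b \<le> (pi / 2) / m" and "(pi / 2) / M \<le> gauss_integral a b"
proof -
  have ab: "a \<noteq> 0" "b \<noteq> 0" using assms by auto
  have "m\<^sup>2 \<le> a\<^sup>2 * (cos t)\<^sup>2 + b\<^sup>2 * (sin t)\<^sup>2" "a\<^sup>2 * (cos t)\<^sup>2 + b\<^sup>2 * (sin t)\<^sup>2 \<le> M\<^sup>2" for t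
  proof -
    have eq: "x\<^sup>2 = x\<^sup>2 * (cos t)\<^sup>2 + x\<^sup>2 * (sin t)\<^sup>2" for x :: real
      by (metis distrib_left mult.right_neutral sin_cos_squared_add2)
    show "m\<^sup>2 \<le> a\<^sup>2 * (cos t)\<^sup>2 + b\<^sup>2 * (sin t)\<^sup>2"
      by (subst eq[of m]) (intro add_mono mult_right_mono power_mono; use assms in auto)
    show "a\<^sup>2 * (cos t)\<^sup>2 + b\<^sup>2 * (sin t)\<^sup>2 \<le> M\<^sup>2"
      by (subst eq[of M]) (intro add_mono mult_right_mono power_mono; use assms in auto)
  qed
  then have "m \<le> sqrt (a\<^sup>2 * (cos t)\<^sup>2 + b\<^sup>2 * (sin t)\<^sup>2)"
    and "sqrt (a\<^sup>2 * (cos t)\<^sup>2 + b\<^sup>2 * (sin t)\<^sup>2) \<le> M" for t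
    using assms by (auto intro: real_le_rsqrt real_le_lsqrt)
  then have *: "1 / sqrt (a\<^sup>2 * (cos t)\<^sup>2 + b\<^sup>2 * (sin t)\<^sup>2) \<le> 1 / m"
    "1 / M \<le> 1 / sqrt (a\<^sup>2 * (cos t)\<^sup>2 + b\<^sup>2 * (sin t)\<^sup>2)" for t
    using assms gauss_form_pos[OF ab, of t] by (auto intro!: divide_left_mono mult_pos_pos)
  have const: "integral {0..pi/2} (\<lambda>t. 1 / x) = (pi / 2) / x" for x :: real
    by simp
  show "gauss_integral a b \<le> (pi / 2) / m"
    unfolding gauss_integral_def const[symmetric]
    by (intro integral_le gauss_integrand_integrable ab integrable_const_ivl *)
  show "(pi / 2) / M \<le> gauss_integral a b"
    unfolding gauss_integral_def const[symmetric]
    by (intro integral_le gauss_integrand_integrable ab integrable_const_ivl *)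
qed

lemma gauss_integral_pos:
  assumes "0 < a" "0 < b"
  shows "0 < gauss_integral a b"
proof -
  have "0 < (pi / 2) / max a b" using assms by auto
  also have "\<dots> \<le> gauss_integral a b"
    using assms by (intro gauss_integral_bounds(2)[of "min a b"]) auto
  finally show ?thesis .
qed

lemma gauss_integral_strict_antimono:
  assumes "0 < a" "0 < b" "b < b'"
  shows "gauss_integral a b' < gauss_integral a b"
  unfolding gauss_integral_def
proof (rule integral_less_real)
  have "pi / 4 \<in> {0<..<pi/2}" by simp
  then show "{0<..<pi/2} \<noteq> {}" by blast
next
  fix t :: real assume t: "t \<in> {0<..<pi/2}"
  then have "0 < (sin t)\<^sup>2"
    using sin_gt_zero[of t] by auto
  then have "a\<^sup>2 * (cos t)\<^sup>2 + b\<^sup>2 * (sin t)\<^sup>2 < a\<^sup>2 * (cos t)\<^sup>2 + b'\<^sup>2 * (sin t)\<^sup>2"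
    using assms by (auto intro: power_strict_mono)
  then show "1 / sqrt (a\<^sup>2 * (cos t)\<^sup>2 + b'\<^sup>2 * (sin t)\<^sup>2) < 1 / sqrt (a\<^sup>2 * (cos t)\<^sup>2 + b\<^sup>2 * (sin t)\<^sup>2)"
    using assms gauss_form_pos[of a b t] gauss_form_pos[of a b' t]
    by (intro divide_strict_left_mono) auto
qed (use assms in \<open>auto intro!: gauss_integrand_continuous\<close>)

text \<open>Landen's substitution. Classically \<open>s = t + arctan ((b/a) tan t)\<close>, which maps \<open>[0, \<pi>/2]\<close> onto
  \<open>[0, \<pi>]\<close> and doubles the integral. The equivalent form
  \<open>s = 2t - arctan ((a - b) sin t cos t / (a cos\<^sup>2 t + b sin\<^sup>2 t))\<close> used here is smooth at \<open>t = \<pi>/2\<close> as well,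
  because the denominator never vanishes. The proof rests on \<open>cos s = (a cos\<^sup>2 t - b sin\<^sup>2 t) / D\<close> and
  \<open>ds/dt = (a + b) N / D\<^sup>2\<close> with \<open>N\<close> that denominator and \<open>D\<^sup>2 = a\<^sup>2 cos\<^sup>2 t + b\<^sup>2 sin\<^sup>2 t\<close>.\<close>

theorem gauss_integral_agm:
  assumes "0 < a" "0 < b"
  shows "gauss_integral ((a + b) / 2) (sqrt (a * b)) = gauss_integral a b"
proof -
  define a' where "a' = (a + b) / 2"
  define f where "f = (\<lambda>x. 1 / sqrt (a'\<^sup>2 * (cos x)\<^sup>2 + (sqrt (a * b))\<^sup>2 * (sin x)\<^sup>2))"
  define N where "N = (\<lambda>t. a * (cos t)\<^sup>2 + b * (sin t)\<^sup>2)"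
  define M where "M = (\<lambda>t. (a - b) * sin t * cos t)"
  define D where "D = (\<lambda>t. sqrt (a\<^sup>2 * (cos t)\<^sup>2 + b\<^sup>2 * (sin t)\<^sup>2))"
  define g where "g = (\<lambda>t. 2 * t - arctan (M t / N t))"
  have sq: "(sin t)\<^sup>2 = 1 - (cos t)\<^sup>2" for t :: real
    by (rule sin_squared_eq)
  have N: "N t > 0" for t
    using gauss_form_pos[of "sqrt a" "sqrt b" t] assms by (simp add: N_def)
  have D: "D t > 0" for t
    using gauss_form_pos[of a b t] assms by (simp add: D_def)
  have D2: "(D t)\<^sup>2 = a\<^sup>2 * (cos t)\<^sup>2 + b\<^sup>2 * (sin t)\<^sup>2" for t
    using gauss_form_pos[of a b t] assms by (simp add: D_def)
  have NM: "(N t)\<^sup>2 + (M t)\<^sup>2 = (D t)\<^sup>2" for t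
    unfolding D2 N_def M_def power_mult_distrib power2_sum sq by algebra
  have NM_ratio: "1 + (M t / N t)\<^sup>2 = (D t)\<^sup>2 / (N t)\<^sup>2" for t
    unfolding power_divide NM[symmetric] using N[of t] by (simp add: field_simps)
  have deriv: "(g has_field_derivative (a + b) * N t / (D t)\<^sup>2) (at t within S)" for t S
  proof -
    define M' where "M' = (a - b) * ((cos t)\<^sup>2 - (sin t)\<^sup>2)"
    define N' where "N' = 2 * (b - a) * sin t * cos t"
    have M: "(M has_field_derivative M') (at t within S)"
      unfolding M_def M'_def by (auto intro!: derivative_eq_intros simp: power2_eq_square algebra_simps)
    have N': "(N has_field_derivative N') (at t within S)"
      unfolding N_def N'_def by (auto intro!: derivative_eq_intros simp: algebra_simps)
    have "(g has_field_derivative 2 - (inverse (1 + (M t / N t)\<^sup>2) * ((M' * N t - M t * N') / (N t * N t))))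
        (at t within S)"
      unfolding g_def using N[of t]
      by (intro DERIV_diff DERIV_chain'[OF DERIV_quotient[OF M N', unfolded power2_eq_square] DERIV_arctan, THEN DERIV_cong]
          DERIV_cmult_Id) (auto)
    moreover have "inverse (1 + (M t / N t)\<^sup>2) * ((M' * N t - M t * N') / (N t * N t)) =
        (M' * N t - M t * N') / (D t)\<^sup>2"
      unfolding NM_ratio using N[of t] by (simp add: power2_eq_square)
    moreover have "2 - (M' * N t - M t * N') / (D t)\<^sup>2 = (a + b) * N t / (D t)\<^sup>2"
    proof -
      have "2 * (D t)\<^sup>2 - (M' * N t - M t * N') = (a + b) * N t"
        unfolding D2 unfolding M'_def N'_def N_def M_def using sq[of t] by algebra
      then show ?thesis using D[of t] by (simp add: field_simps)
    qed
    ultimately show ?thesis by simp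
  qed
  have cos_g: "cos (g t) = (a * (cos t)\<^sup>2 - b * (sin t)\<^sup>2) / D t" for t
  proof -
    have "sqrt (1 + (M t / N t)\<^sup>2) = D t / N t"
    proof (rule real_sqrt_unique)
      show "(D t / N t)\<^sup>2 = 1 + (M t / N t)\<^sup>2"
        unfolding NM_ratio by (rule power_divide)
    qed (use N[of t] D[of t] in simp)
    then have "cos (arctan (M t / N t)) = N t / D t" "sin (arctan (M t / N t)) = M t / D t"
      using N[of t] by (simp_all add: cos_arctan sin_arctan)
    then have "cos (g t) = (cos (2 * t) * N t + sin (2 * t) * M t) / D t"
      unfolding g_def cos_diff by (simp add: add_divide_distrib)
    moreover have "cos (2 * t) * N t + sin (2 * t) * M t = a * (cos t)\<^sup>2 - b * (sin t)\<^sup>2"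
      unfolding cos_double sin_double N_def M_def using sq[of t] by algebra
    ultimately show ?thesis by simp
  qed
  have fg: "(a + b) * N t / (D t)\<^sup>2 * f (g t) = 2 / D t" for t
  proof -
    have "a'\<^sup>2 * (cos (g t))\<^sup>2 + (sqrt (a * b))\<^sup>2 * (sin (g t))\<^sup>2 = ((a + b) * N t / (2 * D t))\<^sup>2"
    proof -
      have "a'\<^sup>2 * (cos (g t))\<^sup>2 + (sqrt (a * b))\<^sup>2 * (sin (g t))\<^sup>2 =
          ((a - b) / 2)\<^sup>2 * (cos (g t))\<^sup>2 + a * b"
        unfolding sq[of "g t"] a'_def using assms by (simp add: power2_eq_square field_simps)
      also have "\<dots> = ((a - b)\<^sup>2 * (a * (cos t)\<^sup>2 - b * (sin t)\<^sup>2)\<^sup>2 + 4 * a * b * (D t)\<^sup>2) / (4 * (D t)\<^sup>2)"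
        unfolding cos_g using D[of t] by (simp add: power_divide field_simps)
      also have "(a - b)\<^sup>2 * (a * (cos t)\<^sup>2 - b * (sin t)\<^sup>2)\<^sup>2 + 4 * a * b * (D t)\<^sup>2 = ((a + b) * N t)\<^sup>2"
        unfolding D2 N_def using sq[of t] by algebra
      also have "\<dots> / (4 * (D t)\<^sup>2) = ((a + b) * N t / (2 * D t))\<^sup>2"
        by (simp add: power_divide power_mult_distrib)
      finally show ?thesis .
    qed
    then have "f (g t) = 1 / ((a + b) * N t / (2 * D t))"
      unfolding f_def using N[of t] D[of t] assms by simp
    moreover have "x / d\<^sup>2 * (1 / (x / (2 * d))) = 2 / d" if "x > 0" "d > 0" for x d :: real
      using that by (simp add: field_simps power2_eq_square)
    from this[of "(a + b) * N t" "D t"]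
    have "(a + b) * N t / (D t)\<^sup>2 * (1 / ((a + b) * N t / (2 * D t))) = 2 / D t"
      using N[of t] D[of t] assms by simp
    ultimately show ?thesis by simp
  qed
  have f_cont: "continuous_on S f" for S
    unfolding f_def a'_def using assms by (intro gauss_integrand_continuous) auto
  have "((\<lambda>t. ((a + b) * N t / (D t)\<^sup>2) *\<^sub>R f (g t)) has_integral (integral {g 0..g (pi/2)} f)) {0..pi/2}"
  proof (rule has_integral_substitution)
    show "g 0 \<le> g (pi / 2)"
      by (simp add: g_def M_def)
    show "g ` {0..pi/2} \<subseteq> {-pi..2*pi}"
    proof safe
      fix t :: real assume "t \<in> {0..pi/2}"
      then show "g t \<in> {-pi..2*pi}"
        using arctan_bounded[of "M t / N t"] by (auto simp: g_def)
    qed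
  qed (auto intro: f_cont deriv)
  then have "((\<lambda>t. 2 * (1 / D t)) has_integral (integral {0..pi} f)) {0..pi/2}"
    unfolding real_scaleR_def fg by (simp add: g_def M_def)
  moreover have "((\<lambda>t. 2 * (1 / D t)) has_integral (2 * gauss_integral a b)) {0..pi/2}"
    unfolding gauss_integral_def D_def using assms
    by (intro has_integral_mult_right integrable_integral gauss_integrand_integrable) auto
  ultimately have "integral {0..pi} f = 2 * gauss_integral a b"
    by (rule has_integral_unique)
  moreover have "integral {0..pi} f = integral {0..pi/2} f + integral {pi/2..pi} f"
    by (subst Henstock_Kurzweil_Integration.integral_combine)
       (auto intro: integrable_continuous_real f_cont)
  \<comment> \<open>The function \<open>f\<close> is even and has period \<open>\<pi>\<close>.\<close>
  moreover have "integral {pi/2..pi} f = integral {0..pi/2} f"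
  proof -
    have "integral {pi/2..pi} f = integral {-(pi/2)..0} (f \<circ> (\<lambda>x. x + pi))"
      using integral_shift[of "-(pi/2)" pi 0 f] f_cont by simp
    also have "f \<circ> (\<lambda>x. x + pi) = (\<lambda>x. f (- x))"
      by (auto simp: f_def)
    also have "integral {-(pi/2)..0} (\<lambda>x. f (- x)) = integral {0..pi/2} f"
      using Henstock_Kurzweil_Integration.integral_reflect_real[of "pi/2" 0 f] unfolding minus_zero .
    finally show ?thesis .
  qed
  ultimately have "integral {0..pi/2} f = gauss_integral a b"
    by simp
  then show ?thesis
    unfolding gauss_integral_def f_def a'_def .
qed

text \<open>An elementary integral with the same logarithmic growth as \<open>I(c, b)\<close> for \<open>b \<rightarrow> 0\<close>. The growth
  comes from \<open>t\<close> near \<open>\<pi>/2\<close>, where the weight \<open>sin t\<close> is close to one.\<close>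

lemma has_integral_sin_over_sqrt:
  assumes "0 < c" "0 < b"
  shows "((\<lambda>t. sin t / sqrt (b\<^sup>2 + c\<^sup>2 * (cos t)\<^sup>2)) has_integral (arsinh (c / b) / c)) {0..pi/2}"
proof -
  define F where "F = (\<lambda>t. - arsinh (c * cos t / b) / c)"
  have "((\<lambda>t. sin t / sqrt (b\<^sup>2 + c\<^sup>2 * (cos t)\<^sup>2)) has_integral (F (pi/2) - F 0)) {0..pi/2}"
  proof (rule fundamental_theorem_of_calculus)
    fix t :: real
    have "sqrt ((c * cos t / b)\<^sup>2 + 1) = sqrt (b\<^sup>2 + c\<^sup>2 * (cos t)\<^sup>2) / b"
    proof -
      have "(c * cos t / b)\<^sup>2 + 1 = (b\<^sup>2 + c\<^sup>2 * (cos t)\<^sup>2) / b\<^sup>2"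
        using assms by (simp add: field_simps)
      then show ?thesis using assms by (simp add: real_sqrt_divide)
    qed
    moreover have "0 < b\<^sup>2 + c\<^sup>2 * (cos t)\<^sup>2"
      using assms by (intro add_pos_nonneg) auto
    moreover have "((\<lambda>t. arsinh (c * cos t / b)) has_real_derivative
        1 / sqrt ((c * cos t / b)\<^sup>2 + 1) * (- c * sin t / b)) (at t within {0..pi/2})"
      using assms by (intro DERIV_chain2[OF arsinh_real_has_field_derivative])
        (auto intro!: derivative_eq_intros)
    ultimately have "(F has_real_derivative sin t / sqrt (b\<^sup>2 + c\<^sup>2 * (cos t)\<^sup>2)) (at t within {0..pi/2})"
      unfolding F_def using assms
      by (auto intro!: derivative_eq_intros simp: field_simps simp del: minus_divide_left)
    then show "(F has_vector_derivative sin t / sqrt (b\<^sup>2 + c\<^sup>2 * (cos t)\<^sup>2)) (at t within {0..pi/2})"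
      by (simp add: has_real_derivative_iff_has_vector_derivative)
  qed simp
  then show ?thesis by (simp add: F_def)
qed

lemma gauss_integral_ge_arsinh:
  assumes "0 < a" "0 < b"
  shows "arsinh (a / b) / a \<le> gauss_integral a b"
proof (rule has_integral_le[OF has_integral_sin_over_sqrt[OF assms]])
  show "((\<lambda>t. 1 / sqrt (a\<^sup>2 * (cos t)\<^sup>2 + b\<^sup>2 * (sin t)\<^sup>2)) has_integral gauss_integral a b) {0..pi/2}"
    unfolding gauss_integral_def using assms
    by (intro integrable_integral gauss_integrand_integrable) auto
  fix t :: real
  have "b\<^sup>2 * (sin t)\<^sup>2 \<le> b\<^sup>2 * 1"
    by (intro mult_left_mono) (auto simp: abs_square_le_1)
  then have "sqrt (a\<^sup>2 * (cos t)\<^sup>2 + b\<^sup>2 * (sin t)\<^sup>2) \<le> sqrt (b\<^sup>2 + a\<^sup>2 * (cos t)\<^sup>2)"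
    by simp
  moreover have "0 < sqrt (a\<^sup>2 * (cos t)\<^sup>2 + b\<^sup>2 * (sin t)\<^sup>2)"
    using gauss_form_pos[of a b t] assms by simp
  ultimately show "sin t / sqrt (b\<^sup>2 + a\<^sup>2 * (cos t)\<^sup>2) \<le> 1 / sqrt (a\<^sup>2 * (cos t)\<^sup>2 + b\<^sup>2 * (sin t)\<^sup>2)"
    by (intro frac_le) auto
qed

text \<open>Split the numerator as \<open>1 = (1 - sin t) + sin t\<close>. Since \<open>1 - sin t \<le> cos t\<close>, the first part contributes
  at most \<open>1/a\<close> to the integrand, and the second part integrates exactly. The hypothesis
  \<open>a\<^sup>2 = b\<^sup>2 + c\<^sup>2\<close> has the shape of Jacobi's identity for \<open>(\<theta>\<^sub>3\<^sup>2, \<theta>\<^sub>2\<^sup>2, \<theta>\<^sub>4\<^sup>2)\<close>.\<close>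

lemma gauss_integral_le_arsinh:
  assumes "0 < b" "0 < c" "0 < a" "a\<^sup>2 = b\<^sup>2 + c\<^sup>2"
  shows "gauss_integral a b \<le> (pi / 2) / a + arsinh (c / b) / c"
proof (rule has_integral_le)
  show "((\<lambda>t. 1 / sqrt (a\<^sup>2 * (cos t)\<^sup>2 + b\<^sup>2 * (sin t)\<^sup>2)) has_integral gauss_integral a b) {0..pi/2}"
    unfolding gauss_integral_def using assms
    by (intro integrable_integral gauss_integrand_integrable) auto
  have "((\<lambda>t. 1 / a) has_integral ((pi / 2) / a)) {0..pi/2}"
    using has_integral_const_real[of "1 / a" 0 "pi/2"] by simp
  then show "((\<lambda>t. 1 / a + sin t / sqrt (b\<^sup>2 + c\<^sup>2 * (cos t)\<^sup>2)) has_integral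
      ((pi / 2) / a + arsinh (c / b) / c)) {0..pi/2}"
    by (intro has_integral_add has_integral_sin_over_sqrt assms)
  fix t :: real assume t: "t \<in> {0..pi/2}"
  define s where "s = sqrt (a\<^sup>2 * (cos t)\<^sup>2 + b\<^sup>2 * (sin t)\<^sup>2)"
  have s: "0 < s"
    using gauss_form_pos[of a b t] assms by (simp add: s_def)
  have sin_cos: "0 \<le> sin t" "0 \<le> cos t" "sin t \<le> 1"
    using t by (auto intro: sin_ge_zero cos_ge_zero)
  have "a\<^sup>2 * (cos t)\<^sup>2 + b\<^sup>2 * (sin t)\<^sup>2 = b\<^sup>2 + c\<^sup>2 * (cos t)\<^sup>2"
    unfolding assms(4) sin_squared_eq by (simp add: algebra_simps)
  then have s': "s = sqrt (b\<^sup>2 + c\<^sup>2 * (cos t)\<^sup>2)"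
    by (simp add: s_def)
  have "(1 - sin t)\<^sup>2 \<le> (1 - sin t) * (1 + sin t)"
    using sin_cos unfolding power2_eq_square by (intro mult_left_mono) auto
  also have "\<dots> = (cos t)\<^sup>2"
    unfolding cos_squared_eq by (simp add: power2_eq_square algebra_simps)
  finally have "1 - sin t \<le> cos t"
    using sin_cos(2) by (rule power2_le_imp_le)
  then have "a * (1 - sin t) \<le> a * cos t"
    using assms by simp
  also have "\<dots> \<le> s"
    unfolding s_def using assms sin_cos by (intro real_le_rsqrt) (simp add: power_mult_distrib)
  finally have "(1 - sin t) / s \<le> 1 / a"
    using s assms by (simp add: field_simps)
  then have "1 / s \<le> 1 / a + sin t / s"
    by (simp add: diff_divide_distrib)
  then show "1 / sqrt (a\<^sup>2 * (cos t)\<^sup>2 + b\<^sup>2 * (sin t)\<^sup>2) \<le> 1 / a + sin t / sqrt (b\<^sup>2 + c\<^sup>2 * (cos t)\<^sup>2)"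
    unfolding s'[symmetric] unfolding s_def .
qed

lemma ellK_eq_gauss_integral:
  assumes "0 \<le> k" "k < 1"
  shows "ellK k = gauss_integral 1 (sqrt (1 - k\<^sup>2))"
proof -
  have "k\<^sup>2 \<le> 1"
    using assms by (simp add: power_le_one)
  then have "1 - k\<^sup>2 * (sin t)\<^sup>2 = 1\<^sup>2 * (cos t)\<^sup>2 + (sqrt (1 - k\<^sup>2))\<^sup>2 * (sin t)\<^sup>2" for t
    by (simp add: cos_squared_eq algebra_simps)
  then show ?thesis
    unfolding ellK_def gauss_integral_def by simp
qed

section \<open>Theta constants: duplication formulas and products\<close>

definition theta2 :: "real \<Rightarrow> real" where "theta2 q = q powr (1/4) * theta q q"
definition theta3 :: "real \<Rightarrow> real" where "theta3 q = theta 1 q"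
definition theta4 :: "real \<Rightarrow> real" where "theta4 q = theta (- 1) q"

lemma theta_ge_1:
  assumes "0 < q" "q < 1" "0 < z"
  shows "1 \<le> theta z q"
proof -
  have "(\<Sum>n\<in>{0::int}. z powi n * q powi n\<^sup>2) \<le> theta z q"
    using assms by (intro finite_sum_le_has_sum[OF theta_has_sum]) auto
  then show ?thesis by simp
qed

lemma theta2_pos: "0 < q \<Longrightarrow> q < 1 \<Longrightarrow> 0 < theta2 q"
  using theta_ge_1[of q q] by (auto simp: theta2_def intro!: mult_pos_pos)

lemma theta3_pos: "0 < q \<Longrightarrow> q < 1 \<Longrightarrow> 0 < theta3 q"
  using theta_ge_1[of q 1] by (simp add: theta3_def)

lemma euler_product_identity:
  fixes q :: real
  shows "(\<Prod>j<n. 1 + q ^ (2 * j + 1)) * (\<Prod>j<n. 1 + q ^ (2 * j + 2)) *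
      (\<Prod>j<n. 1 - q ^ (2 * j + 1)) * qfac (q\<^sup>2) n = qfac (q\<^sup>2) (2 * n)"
proof (induction n)
  case (Suc n)
  have "(1 + q ^ (2 * n + 1)) * (1 + q ^ (2 * n + 2)) * (1 - q ^ (2 * n + 1)) * (1 - (q\<^sup>2) ^ (n + 1)) =
      (1 - (q\<^sup>2) ^ (2 * n + 1)) * (1 - (q\<^sup>2) ^ (2 * n + 2))"
    by (simp flip: power_mult add: algebra_simps power_add power2_eq_square power_mult_distrib power_mult)
  then have "((\<Prod>j<n. 1 + q ^ (2 * j + 1)) * (\<Prod>j<n. 1 + q ^ (2 * j + 2)) *
      (\<Prod>j<n. 1 - q ^ (2 * j + 1)) * qfac (q\<^sup>2) n) *
      ((1 + q ^ (2 * n + 1)) * (1 + q ^ (2 * n + 2)) * (1 - q ^ (2 * n + 1)) * (1 - (q\<^sup>2) ^ (n + 1))) =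
      qfac (q\<^sup>2) (2 * n) * ((1 - (q\<^sup>2) ^ (2 * n + 1)) * (1 - (q\<^sup>2) ^ (2 * n + 2)))"
    unfolding Suc.IH by simp
  then show ?case
    unfolding qfac_def by (simp add: mult_ac)
qed (simp add: qfac_def)

text \<open>With \<open>A = \<Prod>(1+q\<^sup>2\<^sup>j\<^sup>+\<^sup>1)\<close>, \<open>B = \<Prod>(1+q\<^sup>2\<^sup>j\<^sup>+\<^sup>2)\<close>, \<open>C = \<Prod>(1-q\<^sup>2\<^sup>j\<^sup>+\<^sup>1)\<close> and \<open>P = \<Prod>(1-q\<^sup>2\<^sup>j\<^sup>+\<^sup>2)\<close>, the triple product at
  \<open>z = 1, -1, q\<close> gives the three theta constants, and \<open>ABC = 1\<close> is Euler's identity.\<close>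

lemma theta_null_products:
  fixes q :: real
  assumes "0 < q" "q < 1"
  obtains A B C P where "0 < A" "0 < B" "0 < C" "0 < P"
    "theta 1 q = P * A\<^sup>2" "theta (- 1) q = P * C\<^sup>2" "theta q q = 2 * P * B\<^sup>2"
    "A * B * C = 1" "phi_neg q = A * B"
proof -
  have q2: "0 < q\<^sup>2" "q\<^sup>2 < 1"
    using assms by (auto simp: power_less_one_iff)
  have even: "summable (\<lambda>j. q ^ (2 * j))"
    using summable_geometric[of "q\<^sup>2"] q2 by (simp only: power_mult real_norm_def abs_of_pos)
  have sums: "summable (\<lambda>j. \<bar>q ^ (2 * j + 1)\<bar>)" "summable (\<lambda>j. \<bar>q ^ (2 * j + 2)\<bar>)"
    "summable (\<lambda>j. \<bar>- (q ^ (2 * j + 1))\<bar>)"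
    using summable_mult[OF even, of q] summable_mult[OF even, of "q\<^sup>2"] assms
    by (simp_all add: power_add power2_eq_square mult_ac)
  have less1: "q ^ (2 * j + 1) < 1" for j
    using assms by (simp add: power_less_one_iff del: power_Suc)
  have pos: "- 1 < q ^ j" for j
    using assms by (smt (verit) zero_less_power)
  obtain A where A: "0 < A" "(\<lambda>n. \<Prod>j<n. 1 + q ^ (2 * j + 1)) \<longlonglongrightarrow> A"
    using prod_one_plus_limit_pos[OF sums(1)] pos by blast
  obtain B where B: "0 < B" "(\<lambda>n. \<Prod>j<n. 1 + q ^ (2 * j + 2)) \<longlonglongrightarrow> B"
    using prod_one_plus_limit_pos[OF sums(2)] pos by blast
  obtain C where "0 < C" "(\<lambda>n. \<Prod>j<n. 1 + - (q ^ (2 * j + 1))) \<longlonglongrightarrow> C"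
    using prod_one_plus_limit_pos[OF sums(3)] less1 by (metis neg_less_iff_less)
  then have C: "0 < C" "(\<lambda>n. \<Prod>j<n. 1 - q ^ (2 * j + 1)) \<longlonglongrightarrow> C"
    by simp_all
  obtain P where P: "0 < P" "qfac (q\<^sup>2) \<longlonglongrightarrow> P"
    using qfac_limit[OF q2] by blast
  have double: "filterlim (\<lambda>n. 2 * n) at_top (sequentially :: nat filter)"
    by (auto intro!: filterlim_subseq simp: strict_mono_def)
  show thesis
  proof
    show "0 < A" "0 < B" "0 < C" "0 < P" by fact+
    have "(\<lambda>n. qfac (q\<^sup>2) n * ((\<Prod>j<n. 1 + q ^ (2 * j + 1)) * (\<Prod>j<n. 1 + q ^ (2 * j + 1))))
        \<longlonglongrightarrow> P * (A * A)"
      by (intro tendsto_mult P A)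
    moreover have "(\<lambda>n. qfac (q\<^sup>2) n * ((\<Prod>j<n. 1 + q ^ (2 * j + 1)) * (\<Prod>j<n. 1 + q ^ (2 * j + 1))))
        \<longlonglongrightarrow> theta 1 q"
      using jacobi_triple_product[OF assms, of 1] by (simp add: prod.distrib)
    ultimately show "theta 1 q = P * A\<^sup>2"
      using LIMSEQ_unique unfolding power2_eq_square by blast
    have "(\<lambda>n. qfac (q\<^sup>2) n * ((\<Prod>j<n. 1 - q ^ (2 * j + 1)) * (\<Prod>j<n. 1 - q ^ (2 * j + 1))))
        \<longlonglongrightarrow> P * (C * C)"
      by (intro tendsto_mult P C)
    moreover have "(\<lambda>n. qfac (q\<^sup>2) n * ((\<Prod>j<n. 1 - q ^ (2 * j + 1)) * (\<Prod>j<n. 1 - q ^ (2 * j + 1))))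
        \<longlonglongrightarrow> theta (- 1) q"
      using jacobi_triple_product[OF assms, of "-1"] by (simp add: prod.distrib)
    ultimately show "theta (- 1) q = P * C\<^sup>2"
      using LIMSEQ_unique unfolding power2_eq_square by blast
    \<comment> \<open>At \<open>z = q\<close> the second factor of the triple product is \<open>B\<close> shifted by one step, starting with
  \<open>1 + q\<^sup>0 = 2\<close>.\<close>
    have tele: "(\<Prod>j<n. 1 + q ^ (2 * j)) = 2 * (\<Prod>j<n. 1 + q ^ (2 * j + 2)) / (1 + q ^ (2 * n))" for n
    proof (induction n)
      case (Suc n)
      have "0 < 1 + q ^ (2 * n)" "0 < 1 + q ^ (2 * Suc n)"
        using pos[of "2 * n"] pos[of "2 * Suc n"] by linarith+
      then show ?case
        using Suc by (simp add: field_simps)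
    qed simp
    have "(\<lambda>n. q ^ (2 * n)) \<longlonglongrightarrow> 0"
      using LIMSEQ_realpow_zero[of "q\<^sup>2"] q2 by (simp add: power_mult)
    then have "(\<lambda>n. qfac (q\<^sup>2) n * ((\<Prod>j<n. 1 + q ^ (2 * j + 2)) *
        (2 * (\<Prod>j<n. 1 + q ^ (2 * j + 2)) / (1 + q ^ (2 * n))))) \<longlonglongrightarrow> P * (B * (2 * B / (1 + 0)))"
      by (intro tendsto_intros P B) auto
    moreover have "(\<lambda>n. qfac (q\<^sup>2) n * ((\<Prod>j<n. 1 + q ^ (2 * j + 2)) *
        (2 * (\<Prod>j<n. 1 + q ^ (2 * j + 2)) / (1 + q ^ (2 * n))))) \<longlonglongrightarrow> theta q q"
      using jacobi_triple_product[OF assms, of q] assms unfolding tele[symmetric]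
      by (simp add: prod.distrib)
    ultimately have "theta q q = P * (B * (2 * B / (1 + 0)))"
      using LIMSEQ_unique by blast
    then show "theta q q = 2 * P * B\<^sup>2"
      by (simp add: power2_eq_square)
    have "(\<lambda>n. (\<Prod>j<n. 1 + q ^ (2 * j + 1)) * (\<Prod>j<n. 1 + q ^ (2 * j + 2)) *
      (\<Prod>j<n. 1 - q ^ (2 * j + 1)) * qfac (q\<^sup>2) n) \<longlonglongrightarrow> A * B * C * P"
      by (intro tendsto_mult A B C P)
    moreover have "(\<lambda>n. (\<Prod>j<n. 1 + q ^ (2 * j + 1)) * (\<Prod>j<n. 1 + q ^ (2 * j + 2)) *
      (\<Prod>j<n. 1 - q ^ (2 * j + 1)) * qfac (q\<^sup>2) n) \<longlonglongrightarrow> P"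
      unfolding euler_product_identity by (rule filterlim_compose[OF P(2) double])
    ultimately have "A * B * C * P = P"
      using LIMSEQ_unique by blast
    then show "A * B * C = 1"
      using P by simp
    have "summable (\<lambda>j. \<bar>q ^ (j + 1)\<bar>)"
      using summable_mult[OF summable_geometric[of q], of q] assms by simp
    then have "convergent_prod (\<lambda>j. 1 + q ^ (j + 1))"
      by (intro abs_convergent_prod_imp_convergent_prod summable_imp_abs_convergent_prod) simp
    then have "(\<lambda>n. \<Prod>j<n. 1 + q ^ (j + 1)) \<longlonglongrightarrow> phi_neg q"
      unfolding phi_neg_def qpochhammer_inf_def
      by (subst LIMSEQ_lessThan_iff_atMost) (use convergent_prod_LIMSEQ in auto)
    from filterlim_compose[OF this double]
    have "(\<lambda>n. \<Prod>j<2 * n. 1 + q ^ (j + 1)) \<longlonglongrightarrow> phi_neg q" .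
    moreover have "(\<Prod>j<2 * n. 1 + q ^ (j + 1)) =
        (\<Prod>j<n. 1 + q ^ (2 * j + 1)) * (\<Prod>j<n. 1 + q ^ (2 * j + 2))" for n
      by (induction n) (simp_all add: mult_ac)
    moreover have "(\<lambda>n. (\<Prod>j<n. 1 + q ^ (2 * j + 1)) * (\<Prod>j<n. 1 + q ^ (2 * j + 2))) \<longlonglongrightarrow> A * B"
      by (intro tendsto_mult A B)
    ultimately show "phi_neg q = A * B"
      using LIMSEQ_unique by simp
  qed
qed

lemma theta4_pos: "0 < q \<Longrightarrow> q < 1 \<Longrightarrow> 0 < theta4 q"
  unfolding theta4_def by (rule theta_null_products[of q]) auto

text \<open>Both sides are monomials in the four products of \<open>theta_null_products\<close>. They agree after multiplication by
  \<open>(ABC)\<^sup>8 = 1\<close>, which trades the powers of \<open>C\<close> in \<open>\<theta>\<^sub>4\<^sup>4\<close> for powers of \<open>\<phi>(-q) = AB\<close>.\<close>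

lemma theta2_theta3_over_theta4:
  assumes "0 < q" "q < 1"
  shows "(theta2 q)\<^sup>2 * (theta3 q)\<^sup>2 = 4 * q powr (1/2) * phi_neg q ^ 12 * (theta4 q) ^ 4"
proof -
  obtain A B C P where ABC: "0 < A" "0 < B" "0 < C" "0 < P"
    "theta 1 q = P * A\<^sup>2" "theta (- 1) q = P * C\<^sup>2" "theta q q = 2 * P * B\<^sup>2"
    "A * B * C = 1" "phi_neg q = A * B"
    using theta_null_products[OF assms] by metis
  have "q powr (1/4) * q powr (1/4) = q powr (1/2)"
    by (simp flip: powr_add)
  then have "(theta2 q)\<^sup>2 * (theta3 q)\<^sup>2 = 4 * q powr (1/2) * P ^ 4 * (A * B) ^ 4"
    unfolding theta2_def theta3_def ABC by (simp add: power2_eq_square power4_eq_xxxx)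
  also have "(A * B) ^ 4 = (A * B) ^ 4 * (A * B * C) ^ 8"
    using ABC by simp
  also have "\<dots> = (A * B) ^ 12 * C ^ 8"
    by (simp add: power_mult_distrib mult_ac flip: power_add)
  also have "4 * q powr (1/2) * P ^ 4 * ((A * B) ^ 12 * C ^ 8) =
      4 * q powr (1/2) * phi_neg q ^ 12 * (theta4 q) ^ 4"
    unfolding theta4_def ABC by (simp add: power_mult_distrib flip: power_mult)
  finally show ?thesis .
qed

context
  fixes q :: real
  assumes q: "0 < q" "q < 1"
begin

private lemma q2: "0 < q\<^sup>2" "q\<^sup>2 < 1"
  using q by (auto simp: power_less_one_iff)

lemma theta2_square_eq: "(theta2 q)\<^sup>2 = q powr (1/2) * (theta q q)\<^sup>2"
proof -
  have "q powr (1/4) * q powr (1/4) = q powr (1/2)"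
    by (simp flip: powr_add)
  then show ?thesis
    by (simp add: theta2_def power2_eq_square)
qed

private lemma theta2_at_square: "theta2 (q\<^sup>2) = q powr (1/2) * theta (q\<^sup>2) (q\<^sup>2)"
proof -
  have "(q\<^sup>2) powr (1/4) = (q powr 2) powr (1/4)"
    using q by simp
  then show ?thesis
    unfolding theta2_def powr_powr by simp
qed

lemma theta3_square: "(theta3 q)\<^sup>2 = (theta3 (q\<^sup>2))\<^sup>2 + (theta2 (q\<^sup>2))\<^sup>2"
  using theta_mult[OF q, of 1 1] q unfolding theta2_at_square theta3_def
  by (simp add: power2_eq_square mult_ac flip: powr_add)

lemma theta4_square: "(theta4 q)\<^sup>2 = (theta3 (q\<^sup>2))\<^sup>2 - (theta2 (q\<^sup>2))\<^sup>2"
  using theta_mult[OF q, of "-1" "-1"] q unfolding theta2_at_square theta3_def theta4_def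
  by (simp add: power2_eq_square mult_ac flip: powr_add)

lemma theta2_square: "(theta2 q)\<^sup>2 = 2 * theta2 (q\<^sup>2) * theta3 (q\<^sup>2)"
proof -
  \<comment> \<open>The odd class of \<open>theta_mult\<close> at \<open>z = w = q\<close> equals the even class: quasi-periodicity brings \<open>q\<^sup>4\<close> back to \<open>1\<close>.\<close>
  have "theta (q\<^sup>2 * q\<^sup>2) (q\<^sup>2) = theta 1 (q\<^sup>2) / q\<^sup>2"
    using theta_quasi_periodic[OF q2, of 1] by (simp add: power2_eq_square)
  then have "(theta q q)\<^sup>2 = 2 * theta (q\<^sup>2) (q\<^sup>2) * theta 1 (q\<^sup>2)"
    using theta_mult[OF q, of q q] q by (simp add: power2_eq_square)
  then show ?thesis
    unfolding theta2_at_square theta2_square_eq theta3_def by simp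
qed

text \<open>Factor \<open>\<theta>\<^sub>3\<^sup>4 - \<theta>\<^sub>4\<^sup>4\<close> as a difference of squares: the duplication formulas turn it into
  \<open>4 \<theta>\<^sub>2(q\<^sup>2)\<^sup>2 \<theta>\<^sub>3(q\<^sup>2)\<^sup>2 = \<theta>\<^sub>2(q)\<^sup>4\<close>.\<close>

theorem jacobi_theta_quartic: "theta2 q ^ 4 + theta4 q ^ 4 = theta3 q ^ 4"
proof -
  have quartic: "x ^ 4 = (x\<^sup>2)\<^sup>2" for x :: real
    by simp
  show ?thesis
    unfolding quartic theta3_square theta4_square theta2_square by algebra
qed

end

text \<open>The geometric-mean half of the step from \<open>q\<close> to \<open>q\<^sup>2\<close>; it is Jacobi's identity at \<open>q\<^sup>2\<close>, factored.\<close>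

lemma theta3_theta4:
  assumes "0 < q" "q < 1"
  shows "(theta3 q)\<^sup>2 * (theta4 q)\<^sup>2 = theta4 (q\<^sup>2) ^ 4"
proof -
  have "0 < q\<^sup>2" "q\<^sup>2 < 1"
    using assms by (auto simp: power_less_one_iff)
  from jacobi_theta_quartic[OF this] show ?thesis
    unfolding theta3_square[OF assms] theta4_square[OF assms] by algebra
qed

section \<open>Gauss's integral at theta constants\<close>

lemma power_int_tendsto_0:
  fixes x :: "nat \<Rightarrow> real"
  assumes "x \<longlonglongrightarrow> 0" "0 < i"
  shows "(\<lambda>n. x n powi i) \<longlonglongrightarrow> 0"
proof -
  obtain m where m: "i = int m" "0 < m"
    using assms(2) zero_less_imp_eq_int by blast
  have "(\<lambda>n. x n ^ m) \<longlonglongrightarrow> 0 ^ m"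
    by (intro tendsto_power assms)
  then show ?thesis using m by (simp add: zero_power)
qed

context
  fixes x :: "nat \<Rightarrow> real" and q :: real
  assumes q: "0 < q" "q < 1" and x: "\<And>n. 0 < x n" "\<And>n. x n \<le> q" "x \<longlonglongrightarrow> 0"
begin

private lemma powi_le: "0 \<le> i \<Longrightarrow> \<bar>x n powi i\<bar> \<le> q powi i"
  using x(1,2)[of n] by (auto intro!: power_int_mono)

lemma theta_tendsto_1:
  assumes z: "\<bar>z\<bar> = 1"
  shows "(\<lambda>n. theta z (x n)) \<longlonglongrightarrow> 1"
proof -
  have "(\<lambda>n. \<Sum>\<^sub>\<infinity>k. z powi k * x n powi k\<^sup>2) \<longlonglongrightarrow> (\<Sum>\<^sub>\<infinity>k. if k = (0::int) then 1 else 0)"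
  proof (rule infsum_int_dominated_limit)
    show "(\<lambda>n. z powi k * x n powi k\<^sup>2) \<longlonglongrightarrow> (if k = 0 then 1 else 0)" for k :: int
    proof (cases "k = 0")
      case False
      then have "0 < k\<^sup>2" by simp
      then have "(\<lambda>n. z powi k * x n powi k\<^sup>2) \<longlonglongrightarrow> z powi k * 0"
        by (intro tendsto_mult_left power_int_tendsto_0 x)
      then show ?thesis using False by simp
    qed simp
    have "\<bar>z powi k\<bar> = 1" for k
      by (simp add: power_int_abs z)
    then show "\<bar>z powi k * x n powi k\<^sup>2\<bar> \<le> q powi k\<^sup>2" for n and k :: int
      using powi_le[of "k\<^sup>2" n] by (simp add: abs_mult)
    show "(\<lambda>k::int. q powi k\<^sup>2) summable_on UNIV"
      using theta_summable[OF q, of 1] by simp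
  qed
  moreover have "(\<Sum>\<^sub>\<infinity>k. if k = (0::int) then 1 else 0) = (1 :: real)"
    by (intro infsumI has_sum_finite_neutralI[of "{0}"]) auto
  ultimately show ?thesis by (simp add: theta_def)
qed

text \<open>The exponent \<open>n\<^sup>2 + n\<close> vanishes exactly for \<open>n = 0\<close> and \<open>n = -1\<close>; all other terms tend to zero.\<close>

lemma theta_diagonal_tendsto_2: "(\<lambda>n. theta (x n) (x n)) \<longlonglongrightarrow> 2"
proof -
  have eq: "y powi k * y powi k\<^sup>2 = y powi (k + k\<^sup>2)" if "0 < y" for y :: real and k
    using that by (simp add: power_int_add)
  have nonneg: "0 \<le> k + k\<^sup>2" and pos: "k \<noteq> 0 \<Longrightarrow> k \<noteq> -1 \<Longrightarrow> 0 < k + k\<^sup>2" for k :: int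
  proof -
    have *: "k + k\<^sup>2 = k * (k + 1)" by (simp add: power2_eq_square algebra_simps)
    show "0 \<le> k + k\<^sup>2" unfolding * by (cases "k \<ge> 0") (auto intro: mult_nonneg_nonneg mult_nonpos_nonpos)
    show "k \<noteq> 0 \<Longrightarrow> k \<noteq> -1 \<Longrightarrow> 0 < k + k\<^sup>2" unfolding *
      by (cases "k \<ge> 0") (auto intro!: mult_pos_pos mult_neg_neg)
  qed
  have "(\<lambda>n. \<Sum>\<^sub>\<infinity>k. x n powi k * x n powi k\<^sup>2) \<longlonglongrightarrow> (\<Sum>\<^sub>\<infinity>k. if k \<in> {0, -1 :: int} then 1 else 0)"
  proof (rule infsum_int_dominated_limit)
    show "(\<lambda>n. x n powi k * x n powi k\<^sup>2) \<longlonglongrightarrow> (if k \<in> {0, -1} then 1 else 0)" for k :: int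
    proof (cases "k \<in> {0, -1}")
      case False
      then show ?thesis
        unfolding eq[OF x(1)] using pos[of k] by (auto intro: power_int_tendsto_0 x)
    next
      case True
      then have "k + k\<^sup>2 = 0" by auto
      then show ?thesis unfolding eq[OF x(1)] using True by simp
    qed
    show "\<bar>x n powi k * x n powi k\<^sup>2\<bar> \<le> q powi k * q powi k\<^sup>2" for n and k :: int
      unfolding eq[OF x(1)] eq[OF q(1)] by (rule powi_le[OF nonneg])
    show "(\<lambda>k::int. q powi k * q powi k\<^sup>2) summable_on UNIV"
      by (rule theta_summable[OF q])
  qed
  moreover have "(\<Sum>\<^sub>\<infinity>k. if k \<in> {0, -1 :: int} then 1 else 0) = (2 :: real)"
    by (intro infsumI has_sum_finite_neutralI[of "{0, -1}"]) auto
  ultimately show ?thesis by (simp add: theta_def)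
qed

end

context
  fixes q :: real
  assumes q: "0 < q" "q < 1"
begin

private definition sq_iter :: "nat \<Rightarrow> real" where "sq_iter n = q ^ (2 ^ n)"

private lemma sq_iter: "0 < sq_iter n" "sq_iter n < 1" "sq_iter n \<le> q" "sq_iter (Suc n) = (sq_iter n)\<^sup>2"
proof -
  show "0 < sq_iter n" using q by (simp add: sq_iter_def)
  have "q ^ (2 ^ n) \<le> q ^ 1" using q by (intro power_decreasing) auto
  then show "sq_iter n \<le> q" by (simp add: sq_iter_def)
  then show "sq_iter n < 1" using q by linarith
  show "sq_iter (Suc n) = (sq_iter n)\<^sup>2" by (simp add: sq_iter_def mult.commute flip: power_mult)
qed

private lemma sq_iter_0: "sq_iter 0 = q" by (simp add: sq_iter_def)

private lemma sq_iter_tendsto: "sq_iter \<longlonglongrightarrow> 0"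
proof -
  have "filterlim (\<lambda>n. (2::nat) ^ n) at_top sequentially"
    by (auto intro!: filterlim_subseq simp: strict_mono_def)
  then show ?thesis
    unfolding sq_iter_def[abs_def] using q by (auto intro: filterlim_compose[OF LIMSEQ_realpow_zero])
qed

private lemmas sq_iter_hyps = q sq_iter(1,3) sq_iter_tendsto

private lemma theta3_sq_iter: "(\<lambda>n. theta3 (sq_iter n)) \<longlonglongrightarrow> 1"
  unfolding theta3_def by (rule theta_tendsto_1[OF sq_iter_hyps]) simp

private lemma theta4_sq_iter: "(\<lambda>n. theta4 (sq_iter n)) \<longlonglongrightarrow> 1"
  unfolding theta4_def by (rule theta_tendsto_1[OF sq_iter_hyps]) simp

text \<open>The arithmetic-geometric mean iteration started at \<open>(\<theta>\<^sub>3(q)\<^sup>2, \<theta>\<^sub>4(q)\<^sup>2)\<close> runs through the same pair at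
  \<open>q\<^sup>2, q\<^sup>4, q\<^sup>8, \<dots>\<close> and so converges to \<open>(1, 1)\<close>, where the integral is \<open>\<pi>/2\<close>.\<close>

theorem gauss_integral_theta3_theta4: "gauss_integral ((theta3 q)\<^sup>2) ((theta4 q)\<^sup>2) = pi / 2"
proof -
  have step: "gauss_integral ((theta3 (y\<^sup>2))\<^sup>2) ((theta4 (y\<^sup>2))\<^sup>2) = gauss_integral ((theta3 y)\<^sup>2) ((theta4 y)\<^sup>2)"
    if y: "0 < y" "y < 1" for y
  proof -
    have "((theta3 y)\<^sup>2 + (theta4 y)\<^sup>2) / 2 = (theta3 (y\<^sup>2))\<^sup>2"
      using theta3_square[OF y] theta4_square[OF y] by simp
    moreover have "sqrt ((theta3 y)\<^sup>2 * (theta4 y)\<^sup>2) = (theta4 (y\<^sup>2))\<^sup>2"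
      unfolding theta3_theta4[OF y] by (rule real_sqrt_unique) simp_all
    ultimately show ?thesis
      using gauss_integral_agm[of "(theta3 y)\<^sup>2" "(theta4 y)\<^sup>2"] theta3_pos[OF y] theta4_pos[OF y] by simp
  qed
  have const: "gauss_integral ((theta3 (sq_iter n))\<^sup>2) ((theta4 (sq_iter n))\<^sup>2) =
      gauss_integral ((theta3 q)\<^sup>2) ((theta4 q)\<^sup>2)" for n
    by (induction n) (simp_all add: sq_iter_0 sq_iter step)
  have le: "(theta4 (sq_iter n))\<^sup>2 \<le> (theta3 (sq_iter n))\<^sup>2" for n
  proof -
    have "0 \<le> (theta2 ((sq_iter n)\<^sup>2))\<^sup>2" by simp
    then show ?thesis
      using theta3_square[of "sq_iter n"] theta4_square[of "sq_iter n"] sq_iter(1,2)[of n] by linarith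
  qed
  have pos: "0 < (theta4 (sq_iter n))\<^sup>2" for n
    by (intro zero_less_power theta4_pos sq_iter)
  have lower: "(pi / 2) / (theta3 (sq_iter n))\<^sup>2 \<le> gauss_integral ((theta3 q)\<^sup>2) ((theta4 q)\<^sup>2)" for n
    unfolding const[of n, symmetric] using gauss_integral_bounds(2)[OF pos le] le by auto
  have upper: "gauss_integral ((theta3 q)\<^sup>2) ((theta4 q)\<^sup>2) \<le> (pi / 2) / (theta4 (sq_iter n))\<^sup>2" for n
    unfolding const[of n, symmetric] using gauss_integral_bounds(1)[OF pos le] le by auto
  have "(\<lambda>n. (pi / 2) / (theta3 (sq_iter n))\<^sup>2) \<longlonglongrightarrow> (pi / 2) / 1\<^sup>2"
    by (intro tendsto_intros theta3_sq_iter) auto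
  moreover have "(\<lambda>n. (pi / 2) / (theta4 (sq_iter n))\<^sup>2) \<longlonglongrightarrow> (pi / 2) / 1\<^sup>2"
    by (intro tendsto_intros theta4_sq_iter) auto
  ultimately have lim: "(\<lambda>n. (pi / 2) / (theta3 (sq_iter n))\<^sup>2) \<longlonglongrightarrow> pi / 2"
    "(\<lambda>n. (pi / 2) / (theta4 (sq_iter n))\<^sup>2) \<longlonglongrightarrow> pi / 2"
    by simp_all
  show ?thesis
    using LIMSEQ_le_const[OF lim(2)] LIMSEQ_le_const2[OF lim(1)] lower upper by (blast intro: antisym)
qed

private lemma theta2_sq_iter: "(theta2 (sq_iter n))\<^sup>2 = q powr (2 ^ n / 2) * (theta (sq_iter n) (sq_iter n))\<^sup>2"
proof -
  have "sq_iter n powr (1/2) = (q powr (2 ^ n)) powr (1/2)"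
    using q by (simp add: sq_iter_def flip: powr_realpow)
  also have "\<dots> = q powr (2 ^ n / 2)"
    by (simp add: powr_powr)
  finally show ?thesis
    using theta2_square_eq[OF sq_iter(1,2)] by simp
qed

text \<open>At \<open>q^(2^n)\<close>, the constant \<open>\<theta>\<^sub>2\<^sup>2\<close> is \<open>q^(2^n/2)\<close> times a factor tending to \<open>4\<close>.
  Hence \<open>arsinh (y/\<theta>\<^sub>2\<^sup>2)\<close> differs by a bounded amount from \<open>-2\<^sup>n (ln q)/2\<close>.\<close>

private lemma arsinh_theta2_rate:
  assumes "y \<longlonglongrightarrow> 1" and y: "\<And>n. 0 < y n"
  shows "(\<lambda>n. arsinh (y n / (theta2 (sq_iter n))\<^sup>2) / 2 ^ n) \<longlonglongrightarrow> - ln q / 2"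
proof -
  define t where "t n = (theta (sq_iter n) (sq_iter n))\<^sup>2" for n
  define b where "b n = (theta2 (sq_iter n))\<^sup>2" for n
  have t: "t \<longlonglongrightarrow> 2\<^sup>2"
    unfolding t_def[abs_def] by (intro tendsto_power theta_diagonal_tendsto_2[OF sq_iter_hyps])
  have t_pos: "0 < t n" for n
    using theta_ge_1[of "sq_iter n" "sq_iter n"] sq_iter(1,2)[of n] unfolding t_def by auto
  have b_pos: "0 < b n" for n
    using theta2_pos[OF sq_iter(1,2)[of n]] by (simp add: b_def)
  have "(\<lambda>n. sq_iter n powr (1/2)) \<longlonglongrightarrow> 0 powr (1/2)"
    using sq_iter(1) by (intro tendsto_powr' sq_iter_tendsto tendsto_const) (auto intro: always_eventually less_imp_le)
  from tendsto_mult[OF this t] have b: "b \<longlonglongrightarrow> 0"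
    unfolding b_def[abs_def] t_def[abs_def] theta2_square_eq[OF sq_iter(1,2)] by simp
  have half: "(\<lambda>n. (1/2) ^ n :: real) \<longlonglongrightarrow> 0"
    by (rule LIMSEQ_realpow_zero) auto
  have "(\<lambda>n. ln (y n + sqrt ((y n)\<^sup>2 + (b n)\<^sup>2)) * (1/2) ^ n - ln q / 2 - ln (t n) * (1/2) ^ n)
      \<longlonglongrightarrow> ln (1 + sqrt (1\<^sup>2 + 0\<^sup>2)) * 0 - ln q / 2 - ln (2\<^sup>2) * 0"
    by (intro tendsto_intros assms b t half) auto
  moreover have "arsinh (y n / b n) / 2 ^ n =
      ln (y n + sqrt ((y n)\<^sup>2 + (b n)\<^sup>2)) * (1/2) ^ n - ln q / 2 - ln (t n) * (1/2) ^ n" for n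
  proof -
    have "(y n / b n)\<^sup>2 + 1 = ((y n)\<^sup>2 + (b n)\<^sup>2) / (b n)\<^sup>2"
      using b_pos[of n] by (simp add: field_simps)
    then have "sqrt ((y n / b n)\<^sup>2 + 1) = sqrt ((y n)\<^sup>2 + (b n)\<^sup>2) / b n"
      using b_pos[of n] by (simp add: real_sqrt_divide)
    then have "arsinh (y n / b n) = ln ((y n + sqrt ((y n)\<^sup>2 + (b n)\<^sup>2)) / b n)"
      by (simp add: arsinh_real_def add_divide_distrib)
    also have "\<dots> = ln (y n + sqrt ((y n)\<^sup>2 + (b n)\<^sup>2)) - ln (b n)"
      using y[of n] b_pos[of n] by (intro ln_divide_pos add_pos_nonneg) auto
    also have "ln (b n) = 2 ^ n / 2 * ln q + ln (t n)"
      unfolding b_def theta2_sq_iter t_def[symmetric] using q t_pos[of n]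
      by (simp add: ln_mult_pos ln_powr)
    finally show ?thesis
      unfolding power_one_over by (simp add: diff_divide_distrib add_divide_distrib)
  qed
  ultimately show ?thesis by (simp add: b_def)
qed

text \<open>Here the mean step goes in the opposite direction: from \<open>(\<theta>\<^sub>3\<^sup>2, \<theta>\<^sub>2\<^sup>2)\<close> at \<open>q\<^sup>2\<close> it leads to half of
  the pair at \<open>q\<close>. By homogeneity \<open>J(q\<^sup>2) = 2 J(q)\<close>, and the value of \<open>J\<close> is read off from its growth
  along \<open>q, q\<^sup>2, q\<^sup>4, \<dots>\<close>, where the two arsinh bounds agree to leading order.\<close>

theorem gauss_integral_theta3_theta2: "gauss_integral ((theta3 q)\<^sup>2) ((theta2 q)\<^sup>2) = - ln q / 2"
proof -
  define J where "J = (\<lambda>y. gauss_integral ((theta3 y)\<^sup>2) ((theta2 y)\<^sup>2))"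
  have step: "J (y\<^sup>2) = 2 * J y" if y: "0 < y" "y < 1" for y
  proof -
    have y2: "0 < y\<^sup>2" "y\<^sup>2 < 1"
      using y by (auto simp: power_less_one_iff)
    note pos = theta3_pos[OF y2] theta2_pos[OF y2]
    have "((theta3 (y\<^sup>2))\<^sup>2 + (theta2 (y\<^sup>2))\<^sup>2) / 2 = 1 / 2 * (theta3 y)\<^sup>2"
      using theta3_square[OF y] by simp
    moreover have "sqrt ((theta3 (y\<^sup>2))\<^sup>2 * (theta2 (y\<^sup>2))\<^sup>2) = 1 / 2 * (theta2 y)\<^sup>2"
      unfolding theta2_square[OF y] using pos by (simp add: real_sqrt_mult)
    moreover have "J (y\<^sup>2) = gauss_integral (((theta3 (y\<^sup>2))\<^sup>2 + (theta2 (y\<^sup>2))\<^sup>2) / 2)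
        (sqrt ((theta3 (y\<^sup>2))\<^sup>2 * (theta2 (y\<^sup>2))\<^sup>2))"
      unfolding J_def using pos by (intro gauss_integral_agm[symmetric]) auto
    ultimately have "J (y\<^sup>2) = gauss_integral (1 / 2 * (theta3 y)\<^sup>2) (1 / 2 * (theta2 y)\<^sup>2)"
      by (simp only:)
    then show ?thesis
      unfolding J_def by (subst (asm) gauss_integral_scale) auto
  qed
  have J_sq_iter: "J q = J (sq_iter n) / 2 ^ n" for n
    by (induction n) (simp_all add: sq_iter_0 sq_iter step)
  have th: "0 < theta3 (sq_iter n)" "0 < theta2 (sq_iter n)" "0 < theta4 (sq_iter n)" for n
    using theta3_pos theta2_pos theta4_pos sq_iter(1,2) by auto
  define a b c where "a = (\<lambda>n. (theta3 (sq_iter n))\<^sup>2)" and "b = (\<lambda>n. (theta2 (sq_iter n))\<^sup>2)"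
    and "c = (\<lambda>n. (theta4 (sq_iter n))\<^sup>2)"
  have pos: "0 < a n" "0 < b n" "0 < c n" for n
    using th[of n] by (simp_all add: a_def b_def c_def)
  have "a \<longlonglongrightarrow> 1\<^sup>2" "c \<longlonglongrightarrow> 1\<^sup>2"
    unfolding a_def c_def by (intro tendsto_power theta3_sq_iter theta4_sq_iter)+
  then have lim: "a \<longlonglongrightarrow> 1" "c \<longlonglongrightarrow> 1" by simp_all
  have "arsinh (a n / b n) / 2 ^ n / a n \<le> J q" for n
  proof -
    have "arsinh (a n / b n) / a n \<le> J (sq_iter n)"
      using gauss_integral_ge_arsinh[OF pos(1,2)[of n]] by (simp add: J_def a_def b_def)
    then have "arsinh (a n / b n) / a n / 2 ^ n \<le> J (sq_iter n) / 2 ^ n"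
      by (rule divide_right_mono) simp
    then show ?thesis
      unfolding J_sq_iter[of n] by (simp add: mult.commute)
  qed
  moreover have "(\<lambda>n. arsinh (a n / b n) / 2 ^ n / a n) \<longlonglongrightarrow> - ln q / 2 / 1"
    unfolding b_def by (intro tendsto_divide arsinh_theta2_rate lim pos) auto
  ultimately have ge: "- ln q / 2 \<le> J q"
    by (auto intro: LIMSEQ_le_const2)
  have "J q \<le> (pi / 2) * (1/2) ^ n / a n + arsinh (c n / b n) / 2 ^ n / c n" for n
  proof -
    have "(a n)\<^sup>2 = (b n)\<^sup>2 + (c n)\<^sup>2"
      using jacobi_theta_quartic[OF sq_iter(1,2)[of n]] by (simp add: a_def b_def c_def)
    then have "J (sq_iter n) \<le> (pi / 2) / a n + arsinh (c n / b n) / c n"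
      unfolding J_def using gauss_integral_le_arsinh pos by (simp add: a_def b_def c_def)
    then have "J (sq_iter n) / 2 ^ n \<le> ((pi / 2) / a n + arsinh (c n / b n) / c n) / 2 ^ n"
      by (rule divide_right_mono) simp
    then show ?thesis
      unfolding J_sq_iter[of n] by (simp add: field_simps)
  qed
  moreover have "(\<lambda>n. (pi / 2) * (1/2) ^ n / a n + arsinh (c n / b n) / 2 ^ n / c n)
      \<longlonglongrightarrow> (pi / 2) * 0 / 1 + - ln q / 2 / 1"
    unfolding b_def
    by (intro tendsto_add tendsto_divide tendsto_mult arsinh_theta2_rate lim pos LIMSEQ_realpow_zero tendsto_const) auto
  ultimately have "J q \<le> - ln q / 2"
    by (auto intro: LIMSEQ_le_const)
  with ge show ?thesis by (simp add: J_def)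
qed

end

section \<open>The modulus attached to a nome\<close>

definition theta_modulus :: "real \<Rightarrow> real" where
  "theta_modulus q = (theta2 q)\<^sup>2 / (theta3 q)\<^sup>2"

context
  fixes q :: real
  assumes q: "0 < q" "q < 1"
begin

private lemma pos: "0 < theta2 q" "0 < theta3 q" "0 < theta4 q"
  using theta2_pos theta3_pos theta4_pos q by auto

lemma complementary_theta_modulus: "sqrt (1 - (theta_modulus q)\<^sup>2) = (theta4 q)\<^sup>2 / (theta3 q)\<^sup>2"
proof (rule real_sqrt_unique)
  show "((theta4 q)\<^sup>2 / (theta3 q)\<^sup>2)\<^sup>2 = 1 - (theta_modulus q)\<^sup>2"
    using jacobi_theta_quartic[OF q] pos by (simp add: theta_modulus_def power_divide field_simps)
qed simp

lemma theta_modulus_in_unit: "0 < theta_modulus q" "theta_modulus q < 1"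
proof -
  show *: "0 < theta_modulus q"
    using pos by (simp add: theta_modulus_def)
  have "0 < sqrt (1 - (theta_modulus q)\<^sup>2)"
    unfolding complementary_theta_modulus using pos by simp
  then show "theta_modulus q < 1"
    using * by (simp add: abs_square_less_1)
qed

lemma ellK_theta_modulus: "ellK (theta_modulus q) = pi / 2 * (theta3 q)\<^sup>2"
proof -
  have "ellK (theta_modulus q) = gauss_integral 1 ((theta4 q)\<^sup>2 / (theta3 q)\<^sup>2)"
    using theta_modulus_in_unit by (simp add: ellK_eq_gauss_integral complementary_theta_modulus)
  also have "\<dots> = (theta3 q)\<^sup>2 * gauss_integral ((theta3 q)\<^sup>2) ((theta4 q)\<^sup>2)"
    using pos gauss_integral_scale[of "(theta3 q)\<^sup>2" 1 "(theta4 q)\<^sup>2 / (theta3 q)\<^sup>2"] by simp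
  finally show ?thesis
    by (simp add: gauss_integral_theta3_theta4[OF q])
qed

lemma ellK_complementary_theta_modulus:
  "ellK (sqrt (1 - (theta_modulus q)\<^sup>2)) = - ln q / 2 * (theta3 q)\<^sup>2"
proof -
  define k where "k = theta_modulus q"
  have k: "0 < k" "k < 1"
    using theta_modulus_in_unit by (simp_all add: k_def)
  then have k2: "0 < k\<^sup>2" "k\<^sup>2 < 1"
    by (auto simp: power_less_one_iff)
  have "ellK (sqrt (1 - k\<^sup>2)) = gauss_integral 1 k"
    using k k2 by (simp add: ellK_eq_gauss_integral)
  also have "\<dots> = (theta3 q)\<^sup>2 * gauss_integral ((theta3 q)\<^sup>2) ((theta2 q)\<^sup>2)"
    using pos gauss_integral_scale[of "(theta3 q)\<^sup>2" 1 k] by (simp add: k_def theta_modulus_def)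
  finally show ?thesis
    by (simp add: gauss_integral_theta3_theta2[OF q] k_def)
qed

lemma ellK_ratio_theta_modulus:
  "ellK (sqrt (1 - (theta_modulus q)\<^sup>2)) / ellK (theta_modulus q) = - ln q / pi"
  unfolding ellK_theta_modulus ellK_complementary_theta_modulus using pos by simp

text \<open>With \<open>u = \<theta>\<^sub>2\<^sup>2 \<theta>\<^sub>3\<^sup>2 / \<theta>\<^sub>4\<^sup>4\<close> the radicand is \<open>1 + 4u\<^sup>2\<close>, and Jacobi's identity makes it the square of
  \<open>(\<theta>\<^sub>3\<^sup>4 + \<theta>\<^sub>2\<^sup>4)/\<theta>\<^sub>4\<^sup>4\<close>.\<close>

lemma theta_modulus_eq_phi_neg:
  "theta_modulus q = 8 * q powr (1/2) * phi_neg q ^ 12 / (1 + sqrt (1 + 64 * q * phi_neg q ^ 24))"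
proof -
  define u where "u = 4 * q powr (1/2) * phi_neg q ^ 12"
  define a b c where "a = (theta3 q)\<^sup>2" and "b = (theta2 q)\<^sup>2" and "c = (theta4 q)\<^sup>2"
  have abc: "0 < a" "0 < b" "0 < c"
    using pos by (simp_all add: a_def b_def c_def)
  have jac: "a\<^sup>2 = b\<^sup>2 + c\<^sup>2"
    using jacobi_theta_quartic[OF q] by (simp add: a_def b_def c_def)
  have u: "u = b * a / c\<^sup>2"
    using theta2_theta3_over_theta4[OF q] pos by (simp add: u_def a_def b_def c_def field_simps)
  have "(q powr (1/2))\<^sup>2 = q"
    using q by (simp add: powr_half_sqrt)
  then have "1 + 64 * q * phi_neg q ^ 24 = 1 + 4 * u\<^sup>2"
    unfolding u_def by (simp add: power_mult_distrib flip: power_mult)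
  also have "\<dots> = ((a\<^sup>2 + b\<^sup>2) / c\<^sup>2)\<^sup>2"
  proof -
    have "(c\<^sup>2)\<^sup>2 + 4 * (b * a)\<^sup>2 = (a\<^sup>2 + b\<^sup>2)\<^sup>2"
      using jac by algebra
    moreover have "1 + 4 * u\<^sup>2 = ((c\<^sup>2)\<^sup>2 + 4 * (b * a)\<^sup>2) / (c\<^sup>2)\<^sup>2"
      unfolding u using abc by (simp add: power_divide add_divide_distrib)
    ultimately show ?thesis by (simp add: power_divide)
  qed
  finally have "sqrt (1 + 64 * q * phi_neg q ^ 24) = (a\<^sup>2 + b\<^sup>2) / c\<^sup>2"
    by simp
  then have "1 + sqrt (1 + 64 * q * phi_neg q ^ 24) = 2 * a\<^sup>2 / c\<^sup>2"
    using abc jac by (simp add: field_simps)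
  then have "8 * q powr (1/2) * phi_neg q ^ 12 / (1 + sqrt (1 + 64 * q * phi_neg q ^ 24)) =
      2 * u / (2 * a\<^sup>2 / c\<^sup>2)"
    by (simp add: u_def)
  also have "\<dots> = b / a"
    unfolding u using abc by (simp add: power2_eq_square)
  finally show ?thesis
    by (simp add: theta_modulus_def a_def b_def)
qed

end

text \<open>The quotient is \<open>I(1, k)/I(1, k')\<close>, and \<open>I(1, b)\<close> strictly decreases in \<open>b\<close>, while \<open>k'\<close> decreases in \<open>k\<close>.\<close>

lemma ellK_ratio_strict_antimono:
  assumes "0 < k" "k < l" "l < 1"
  shows "ellK (sqrt (1 - l\<^sup>2)) / ellK l < ellK (sqrt (1 - k\<^sup>2)) / ellK k"
proof -
  have sq: "0 < k\<^sup>2" "k\<^sup>2 < l\<^sup>2" "l\<^sup>2 < 1"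
    using assms by (auto simp: power_less_one_iff intro!: power_strict_mono)
  have K: "ellK k = gauss_integral 1 (sqrt (1 - k\<^sup>2))" "ellK l = gauss_integral 1 (sqrt (1 - l\<^sup>2))"
    "ellK (sqrt (1 - k\<^sup>2)) = gauss_integral 1 k" "ellK (sqrt (1 - l\<^sup>2)) = gauss_integral 1 l"
    using assms sq by (simp_all add: ellK_eq_gauss_integral)
  show ?thesis
    unfolding K using assms sq
    by (intro frac_less gauss_integral_strict_antimono less_imp_le[OF gauss_integral_pos]
          gauss_integral_pos less_imp_le[OF gauss_integral_strict_antimono]) auto
qed

text \<open>In terms of \<open>k'\<close> one has \<open>l = (1 - k')/(1 + k')\<close> and \<open>l'\<^sup>2 = 4k'/(1 + k')\<^sup>2\<close>. After taking sixth powers,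
  both identities are rational in \<open>k'\<close> and \<open>k\<close>: \<open>(kl')\<^sup>2/(k'l) = 4\<close> and \<open>kk'l/l'\<^sup>2 = k\<^sup>3/4\<close>.\<close>

lemma landen_modulus_identities:
  fixes k :: real
  assumes k: "0 < k" "k < 1"
  defines "k' \<equiv> sqrt (1 - k\<^sup>2)"
  defines "l \<equiv> (2 - k\<^sup>2 - 2 * k') / k\<^sup>2"
  defines "l' \<equiv> sqrt (1 - l\<^sup>2)"
  shows "(k * l') powr (1/3) / (k' * l) powr (1/6) = 2 powr (1/3)"
    and "(k * k' * l) powr (1/6) / l' powr (1/3) = 2 powr (-1/3) * sqrt k"
proof -
  have k2: "0 < k\<^sup>2" "k\<^sup>2 < 1"
    using k by (auto simp: power_less_one_iff)
  have k': "0 < k'" "k' < 1" "k\<^sup>2 = (1 - k') * (1 + k')"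
    using k2 by (auto simp: k'_def algebra_simps power2_eq_square[symmetric])
  have l: "l = (1 - k') / (1 + k')"
  proof -
    have "l = (1 - k') * (1 - k') / ((1 - k') * (1 + k'))"
      unfolding l_def k'(3) by (simp add: algebra_simps)
    then show ?thesis using k' by simp
  qed
  have l_bounds: "0 < l" "l < 1"
    unfolding l using k' by simp_all
  have l'2: "l'\<^sup>2 = 4 * k' / (1 + k')\<^sup>2"
  proof -
    have "l'\<^sup>2 = 1 - l\<^sup>2"
      using l_bounds by (simp add: l'_def power_le_one)
    also have "\<dots> = ((1 + k')\<^sup>2 - (1 - k')\<^sup>2) / (1 + k')\<^sup>2"
      unfolding l power_divide using k' by (simp add: diff_divide_distrib)
    also have "(1 + k')\<^sup>2 - (1 - k')\<^sup>2 = 4 * k'"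
      by algebra
    finally show ?thesis .
  qed
  have l'_pos: "0 < l'"
    using l_bounds by (simp add: l'_def power_less_one_iff)
  have sixth: "x powr (1/3) = (x\<^sup>2) powr (1/6)" if "0 < x" for x :: real
  proof -
    have "x\<^sup>2 = x powr 2" using that by simp
    then show ?thesis by (simp add: powr_powr)
  qed
  have "(k * l') powr (1/3) / (k' * l) powr (1/6) = ((k * l')\<^sup>2 / (k' * l)) powr (1/6)"
    using k k' l'_pos l_bounds by (simp add: sixth powr_divide)
  also have "(k * l')\<^sup>2 / (k' * l) = 2\<^sup>2"
  proof -
    have "(k * l')\<^sup>2 / (k' * l) = (1 - k') * (1 + k') * (4 * k' / (1 + k')\<^sup>2) / (k' * ((1 - k') / (1 + k')))"
      unfolding power_mult_distrib k'(3) l'2 l ..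
    also have "\<dots> = 4"
      using k' by (simp add: power2_eq_square)
    finally show ?thesis by simp
  qed
  finally show "(k * l') powr (1/3) / (k' * l) powr (1/6) = 2 powr (1/3)"
    by (simp add: sixth)
  have "(k * k' * l) powr (1/6) / l' powr (1/3) = (k * k' * l / l'\<^sup>2) powr (1/6)"
    using k k' l'_pos l_bounds by (simp add: sixth powr_divide)
  also have "k * k' * l / l'\<^sup>2 = k powr 3 * 2 powr (-2)"
  proof -
    have "k * k' * l / l'\<^sup>2 = k * ((1 - k') * (1 + k')) / 4"
      unfolding l'2 l using k' by (simp add: power2_eq_square)
    also have "\<dots> = k ^ 3 / 4"
      unfolding k'(3)[symmetric] by (simp add: power2_eq_square power3_eq_cube)
    finally show ?thesis
      using k by (simp add: powr_minus)
  qed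
  also have "\<dots> powr (1/6) = 2 powr (-1/3) * k powr (1/2)"
    using k by (simp add: powr_mult powr_powr del: powr_numeral)
  finally show "(k * k' * l) powr (1/6) / l' powr (1/3) = 2 powr (-1/3) * sqrt k"
    using k by (simp add: powr_half_sqrt)
qed

theorem theorem1:
  fixes r q :: real
  assumes "r > 0" and "q = exp (- pi * sqrt r)"
  shows "(\<exists>!k. k \<in> {0<..<1} \<and> ellK (sqrt (1 - k\<^sup>2)) / ellK k = sqrt r) \<and>
    (\<forall>k\<in>{0<..<1}. ellK (sqrt (1 - k\<^sup>2)) / ellK k = sqrt r \<longleftrightarrow>
      k = 8 * q powr (1/2) * phi_neg q ^ 12 / (1 + sqrt (1 + 64 * q * phi_neg q ^ 24))) \<and>
    (\<forall>k\<in>{0<..<1}. ellK (sqrt (1 - k\<^sup>2)) / ellK k = sqrt r \<longrightarrow>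
      (let k11 = k;
           k12 = sqrt (1 - k11\<^sup>2);
           k21 = (2 - k11\<^sup>2 - 2 * k12) / k11\<^sup>2;
           k22 = sqrt (1 - k21\<^sup>2)
       in \<forall>m::int.
         ((\<lambda>n::int. q powi (n\<^sup>2 + 2 * m * n)) has_sum
           (2 powr (1/6) * q powi (- m\<^sup>2) *
             ((k11 * k22) powr (1/3) / (k12 * k21) powr (1/6)) * sqrt (ellK k11 / pi))) UNIV \<and>
         ((\<lambda>n::int. q powi (n\<^sup>2 + (2 * m + 1) * n)) has_sum
           (2 powr (5/6) * q powr (- (1/4) * (2 * of_int m + 1)\<^sup>2) *
             ((k11 * k12 * k21) powr (1/6) / k22 powr (1/3)) * sqrt (ellK k11 / pi))) UNIV))"
proof -
  have q: "0 < q" "q < 1"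
    using assms by auto
  define k0 where "k0 = theta_modulus q"
  have k0: "0 < k0" "k0 < 1"
    using theta_modulus_in_unit[OF q] by (simp_all add: k0_def)
  have ratio: "ellK (sqrt (1 - k0\<^sup>2)) / ellK k0 = sqrt r"
    using ellK_ratio_theta_modulus[OF q] by (simp add: k0_def assms(2))
  have char: "ellK (sqrt (1 - k\<^sup>2)) / ellK k = sqrt r \<longleftrightarrow> k = k0" if "k \<in> {0<..<1}" for k
    using ellK_ratio_strict_antimono[of k k0] ellK_ratio_strict_antimono[of k0 k] that k0 ratio
    by (cases k k0 rule: linorder_cases) auto
  have sqrt_K: "sqrt (ellK k0 / pi) = 2 powr (-1/2) * theta3 q"
  proof -
    have "ellK k0 / pi = (theta3 q)\<^sup>2 / 2"
      by (simp add: k0_def ellK_theta_modulus[OF q])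
    moreover have "2 powr (-1/2) = 1 / sqrt (2 :: real)"
      by (simp add: powr_minus_divide powr_half_sqrt)
    ultimately show ?thesis
      using theta3_pos[OF q] by (simp only: real_sqrt_divide real_sqrt_abs abs_of_pos) simp
  qed
  have sqrt_k0: "sqrt k0 * theta3 q = theta2 q"
    using theta2_pos[OF q] theta3_pos[OF q]
    by (simp add: k0_def theta_modulus_def real_sqrt_divide)
  define k1 where "k1 = sqrt (1 - k0\<^sup>2)"
  define l where "l = (2 - k0\<^sup>2 - 2 * k1) / k0\<^sup>2"
  define l1 where "l1 = sqrt (1 - l\<^sup>2)"
  note landen = landen_modulus_identities[OF k0, folded k1_def, folded l_def, folded l1_def]
  have even: "((\<lambda>n::int. q powi (n\<^sup>2 + 2 * m * n)) has_sum
      (2 powr (1/6) * q powi (- m\<^sup>2) * ((k0 * l1) powr (1/3) / (k1 * l) powr (1/6)) *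
       sqrt (ellK k0 / pi))) UNIV" for m
  proof -
    have two: "2 powr (1/6) * 2 powr (1/3) * 2 powr (-1/2) = (1 :: real)"
      by (simp flip: powr_add)
    have "2 powr (1/6) * q powi (- m\<^sup>2) * ((k0 * l1) powr (1/3) / (k1 * l) powr (1/6)) *
        sqrt (ellK k0 / pi) =
        (2 powr (1/6) * 2 powr (1/3) * 2 powr (-1/2)) * (q powi (- m\<^sup>2) * theta3 q)"
      unfolding landen sqrt_K by (simp only: mult_ac)
    also have "\<dots> = q powi (- m\<^sup>2) * theta3 q"
      unfolding two by simp
    finally have "2 powr (1/6) * q powi (- m\<^sup>2) * ((k0 * l1) powr (1/3) / (k1 * l) powr (1/6)) *
        sqrt (ellK k0 / pi) = q powi (- m\<^sup>2) * theta3 q" .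
    then show ?thesis
      using theta_shift_has_sum[OF q, of 1 m] by (simp add: theta3_def)
  qed
  have odd: "((\<lambda>n::int. q powi (n\<^sup>2 + (2 * m + 1) * n)) has_sum
      (2 powr (5/6) * q powr (- (1/4) * (2 * of_int m + 1)\<^sup>2) *
       ((k0 * k1 * l) powr (1/6) / l1 powr (1/3)) * sqrt (ellK k0 / pi))) UNIV" for m
  proof -
    have two: "2 powr (5/6) * 2 powr (-1/3) * 2 powr (-1/2) = (1 :: real)"
      by (simp flip: powr_add)
    have "2 powr (5/6) * q powr (- (1/4) * (2 * of_int m + 1)\<^sup>2) *
        ((k0 * k1 * l) powr (1/6) / l1 powr (1/3)) * sqrt (ellK k0 / pi) =
        (2 powr (5/6) * 2 powr (-1/3) * 2 powr (-1/2)) *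
        q powr (- (1/4) * (2 * of_int m + 1)\<^sup>2) * (sqrt k0 * theta3 q)"
      unfolding landen sqrt_K by (simp only: mult_ac)
    also have "\<dots> = q powr (- (1/4) * (2 * of_int m + 1)\<^sup>2) * q powr (1/4) * theta q q"
      unfolding two sqrt_k0 theta2_def by simp
    also have "q powr (- (1/4) * (2 * of_int m + 1)\<^sup>2) * q powr (1/4) = q powr (real_of_int (- m - m\<^sup>2))"
      unfolding powr_add[symmetric] by (rule arg_cong[of _ _ "\<lambda>e. q powr e"])
        (simp add: power2_eq_square algebra_simps)
    also have "\<dots> = q powi (- m - m\<^sup>2)"
      using q by (intro powr_real_of_int') auto
    also have "\<dots> = q powi (- m) * q powi (- m\<^sup>2)"
      using q by (subst power_int_add[symmetric]) auto
    finally have "2 powr (5/6) * q powr (- (1/4) * (2 * of_int m + 1)\<^sup>2) *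
        ((k0 * k1 * l) powr (1/6) / l1 powr (1/3)) * sqrt (ellK k0 / pi) =
        q powi (- m) * q powi (- m\<^sup>2) * theta q q" .
    moreover have "q powi n * q powi (n\<^sup>2 + 2 * m * n) = q powi (n\<^sup>2 + (2 * m + 1) * n)" for n
      using q by (subst power_int_add[symmetric]) (auto simp: algebra_simps)
    ultimately show ?thesis
      using theta_shift_has_sum[OF q, of q m] q by simp
  qed
  show ?thesis
  proof (intro conjI ballI impI)
    show "\<exists>!k. k \<in> {0<..<1} \<and> ellK (sqrt (1 - k\<^sup>2)) / ellK k = sqrt r"
      using char k0 by (intro ex1I[of _ k0]) auto
    show "(ellK (sqrt (1 - k\<^sup>2)) / ellK k = sqrt r) =
        (k = 8 * q powr (1/2) * phi_neg q ^ 12 / (1 + sqrt (1 + 64 * q * phi_neg q ^ 24)))"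
      if "k \<in> {0<..<1}" for k
      using char[OF that] theta_modulus_eq_phi_neg[OF q] by (simp add: k0_def)
    fix k :: real
    assume "k \<in> {0<..<1}" and "ellK (sqrt (1 - k\<^sup>2)) / ellK k = sqrt r"
    then have k: "k = k0"
      using char by blast
    show "let k11 = k;
           k12 = sqrt (1 - k11\<^sup>2);
           k21 = (2 - k11\<^sup>2 - 2 * k12) / k11\<^sup>2;
           k22 = sqrt (1 - k21\<^sup>2)
       in \<forall>m::int.
         ((\<lambda>n::int. q powi (n\<^sup>2 + 2 * m * n)) has_sum
           (2 powr (1/6) * q powi (- m\<^sup>2) *
             ((k11 * k22) powr (1/3) / (k12 * k21) powr (1/6)) * sqrt (ellK k11 / pi))) UNIV \<and>
         ((\<lambda>n::int. q powi (n\<^sup>2 + (2 * m + 1) * n)) has_sum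
           (2 powr (5/6) * q powr (- (1/4) * (2 * of_int m + 1)\<^sup>2) *
             ((k11 * k12 * k21) powr (1/6) / k22 powr (1/3)) * sqrt (ellK k11 / pi))) UNIV"
      unfolding Let_def k k1_def[symmetric] l_def[symmetric] l1_def[symmetric]
      using even odd by blast
  qed
qed

end
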